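(* Let $\mathcal{G}=(B,\psi,A)$ be a finite quantum graph such that $A$ is completely positive and $\psi$ is a $\delta$-form, and let $E_{\mathcal{G}}$ be its quantum edge correspondence. If $E_{\mathcal{G}}$ is periodic, then $E_{\mathcal{G}}$ is faithful and full (i.e. $\mathcal{G}$ has no quantum sources and no quantum sinks).
   Context: Quantum graphs: $B$ is a finite-dimensional C*-algebra, $\psi$ a state on $B$, $L^2(B,\psi)$ is $B$ with inner product $\psi(x^*y)$, $m:L^2(B\otimes B,\psi\otimes\psi)\to L^2(B,\psi)$ is $m(x\otimes y)=xy$, and $m^*$ is its Hilbert space adjoint. For $\delta>0$, $\psi$ is a $\delta$-form if $mm^*=\delta^2\,\mathrm{id}_B$. A linear map $A:B\to B$ is quantum Schur idempotent if $m(A\otimes A)m^*=\delta^2A$. A finite quantum graph is a triple $\mathcal{G}=(B,\psi,A)$ with $A$ quantum Schur idempotent (here also completely positive). A quantum source is a (nonzero) central summand of $B$ contained in $\ker(A)$; a quantum sink is a (nonzero) central summand of $B$ orthogonal to the range of $A$. Quantum edge correspondence: $B\otimes_\psi B$ is $B\otimes B$ with actions $a\cdot(x\otimes y)\cdot b=ax\otimes yb$ and inner product $\langle x\otimes y\,|\,z\otimes w\rangle=y^*\psi(x^*z)w$. Put $\varepsilon_{\mathcal{G}}:=\delta^{-2}(\mathrm{id}_B\otimes A)m^*(1_B)$ and $E_{\mathcal{G}}:=\mathrm{Span}\{x\cdot\varepsilon_{\mathcal{G}}\cdot y:x,y\in B\}\subseteq B\otimes_\psi B$; its inner product satisfies $\langle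 x_1\cdot\varepsilon_{\mathcal{G}}\cdot y_1\,|\,x_2\cdot\varepsilon_{\mathcal{G}}\cdot y_2\rangle=\delta^{-2}y_1^*A(x_1^*x_2)y_2$. A C*-correspondence $X$ over a unital C*-algebra $B$ is aperiodic if whenever $X^{\otimes n}$ (internal tensor power over $B$) is isomorphic to $B$ as correspondences over $B$, $n$ must be $0$; it is periodic if it is not aperiodic, i.e. $X^{\otimes n}\cong B$ for some $n\geq1$. $X$ is faithful if its left action is injective, and full if $\overline{\mathrm{span}}\,\langle X\,|\,X\rangle=B$. *)

theory Defs
  imports "HOL-Analysis.Analysis" "HOL-Library.Poly_Mapping"
begin

section \<open>Finite-dimensional C*-algebras\<close>

class complex_vector = real_vector +
  fixes scaleC :: "complex \<Rightarrow> 'a \<Rightarrow> 'a"  (infixr \<open>*\<^sub>C\<close> 75)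
  assumes scaleC_add_right: "c *\<^sub>C (x + y) = c *\<^sub>C x + c *\<^sub>C y"
    and scaleC_add_left: "(c + d) *\<^sub>C x = c *\<^sub>C x + d *\<^sub>C x"
    and scaleC_scaleC: "c *\<^sub>C (d *\<^sub>C x) = (c * d) *\<^sub>C x"
    and scaleC_one: "1 *\<^sub>C x = x"
    and scaleR_scaleC: "r *\<^sub>R x = complex_of_real r *\<^sub>C x"

interpretation complex_vector: vector_space "scaleC :: complex \<Rightarrow> 'a \<Rightarrow> 'a::complex_vector"
  by unfold_locales (simp_all add: scaleC_add_right scaleC_add_left scaleC_scaleC scaleC_one)

abbreviation cspan :: "'a::complex_vector set \<Rightarrow> 'a set" where
  "cspan \<equiv> complex_vector.span"

abbreviation clinear :: "('a::complex_vector \<Rightarrow> 'b::complex_vector) \<Rightarrow> bool" where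
  "clinear \<equiv> Vector_Spaces.linear scaleC scaleC"

text \<open>Unital, as every finite-dimensional C*-algebra is, and nonzero: the zero algebra
  has no states.\<close>

class cstar_algebra = complex_vector + banach + real_normed_algebra_1 +
  fixes star :: "'a \<Rightarrow> 'a"
  assumes mult_scaleC_left: "(c *\<^sub>C x) * y = c *\<^sub>C (x * y)"
    and mult_scaleC_right: "x * (c *\<^sub>C y) = c *\<^sub>C (x * y)"
    and norm_scaleC: "norm (c *\<^sub>C x) = cmod c * norm x"
    and star_add: "star (x + y) = star x + star y"
    and star_scaleC: "star (c *\<^sub>C x) = cnj c *\<^sub>C star x"
    and star_mult: "star (x * y) = star y * star x"
    and star_star: "star (star x) = x"
    and cstar_identity: "norm (star x * x) = (norm x)\<^sup>2"

class fin_dim_cstar_algebra = cstar_algebra +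
  assumes fin_dim: "\<exists>S. finite S \<and> (\<forall>x. \<exists>c. x = (\<Sum>s\<in>S. c s *\<^sub>C s))"

instantiation complex :: complex_vector
begin
definition scaleC_complex_def: "c *\<^sub>C (z::complex) = c * z"
instance
  by standard (simp_all add: scaleC_complex_def algebra_simps scaleR_conv_of_real)
end

text \<open>Positive elements of the matrix algebra \<open>M\<^sub>n(B)\<close> are those of the form \<open>Y\<^sup>*Y\<close>; only the
  entries with indices below \<open>n\<close> are relevant.\<close>

definition positive_matrix :: "nat \<Rightarrow> (nat \<Rightarrow> nat \<Rightarrow> 'b::cstar_algebra) \<Rightarrow> bool" where
  "positive_matrix n P \<longleftrightarrow>
     (\<exists>Y. \<forall>i<n. \<forall>j<n. P i j = (\<Sum>k<n. star (Y k i) * Y k j))"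

definition completely_positive :: "('b::cstar_algebra \<Rightarrow> 'b) \<Rightarrow> bool" where
  "completely_positive A \<longleftrightarrow>
     clinear A \<and>
     (\<forall>n P. positive_matrix n P \<longrightarrow> positive_matrix n (\<lambda>i j. A (P i j)))"

text \<open>Faithfulness of the state is what makes \<open>\<psi>(x\<^sup>*y)\<close> an inner product on all of \<open>B\<close>.\<close>

definition faithful_state :: "('b::cstar_algebra \<Rightarrow> complex) \<Rightarrow> bool" where
  "faithful_state \<psi> \<longleftrightarrow>
     clinear \<psi> \<and> \<psi> 1 = 1 \<and>
     (\<forall>x. \<psi> (star x * x) \<in> \<real>\<^sub>\<ge>\<^sub>0) \<and>
     (\<forall>x. \<psi> (star x * x) = 0 \<longrightarrow> x = 0)"

definition central_summand :: "'b::cstar_algebra set \<Rightarrow> bool" where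
  "central_summand S \<longleftrightarrow>
     (\<exists>p. p * p = p \<and> star p = p \<and> (\<forall>x. p * x = x * p) \<and> S = range (\<lambda>x. p * x))"


section \<open>Tensor products of complex vector spaces\<close>

instantiation poly_mapping :: (type, complex_vector) complex_vector
begin
definition scaleC_poly_mapping_def: "c *\<^sub>C (f :: 'a \<Rightarrow>\<^sub>0 'b) = Poly_Mapping.map (scaleC c) f"
definition scaleR_poly_mapping_def: "r *\<^sub>R (f :: 'a \<Rightarrow>\<^sub>0 'b) = complex_of_real r *\<^sub>C f"

lemma lookup_scaleC [simp]: "Poly_Mapping.lookup (c *\<^sub>C (f :: 'a \<Rightarrow>\<^sub>0 'b)) k = c *\<^sub>C Poly_Mapping.lookup f k"
  by (simp add: scaleC_poly_mapping_def map.rep_eq when_def)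

instance
  by standard
    (simp_all add: poly_mapping_eq_iff fun_eq_iff lookup_add scaleR_poly_mapping_def
      scaleC_add_right scaleC_add_left scaleC_scaleC scaleC_one)
end

text \<open>Linear extension of a function on the generators of a free vector space.\<close>

definition free_lift :: "('k \<Rightarrow> 'c::complex_vector) \<Rightarrow> ('k \<Rightarrow>\<^sub>0 complex) \<Rightarrow> 'c" where
  "free_lift g f = (\<Sum>k\<in>Poly_Mapping.keys f. Poly_Mapping.lookup f k *\<^sub>C g k)"

text \<open>Sesquilinear extension, conjugate-linear in the first argument.\<close>

definition free_sesq ::
    "('k \<Rightarrow> 'k \<Rightarrow> 'c::complex_vector) \<Rightarrow> ('k \<Rightarrow>\<^sub>0 complex) \<Rightarrow> ('k \<Rightarrow>\<^sub>0 complex) \<Rightarrow> 'c" where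
  "free_sesq g f h =
     (\<Sum>k\<in>Poly_Mapping.keys f. \<Sum>l\<in>Poly_Mapping.keys h. (cnj (Poly_Mapping.lookup f k) * Poly_Mapping.lookup h l) *\<^sub>C g k l)"

definition tensor_relators :: "(('a::complex_vector \<times> 'b::complex_vector) \<Rightarrow>\<^sub>0 complex) set" where
  "tensor_relators =
     {Poly_Mapping.single (x + x', y) 1 - Poly_Mapping.single (x, y) 1
        - Poly_Mapping.single (x', y) 1 | x x' y. True} \<union>
     {Poly_Mapping.single (x, y + y') 1 - Poly_Mapping.single (x, y) 1
        - Poly_Mapping.single (x, y') 1 | x y y'. True} \<union>
     {Poly_Mapping.single (c *\<^sub>C x, y) 1 - c *\<^sub>C Poly_Mapping.single (x, y) 1 | c x y. True} \<union>
     {Poly_Mapping.single (x, c *\<^sub>C y) 1 - c *\<^sub>C Poly_Mapping.single (x, y) 1 | c x y. True}"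

definition tensor_equiv ::
    "(('a::complex_vector \<times> 'b::complex_vector) \<Rightarrow>\<^sub>0 complex) \<Rightarrow> (('a \<times> 'b) \<Rightarrow>\<^sub>0 complex) \<Rightarrow> bool"
  where "tensor_equiv f g \<longleftrightarrow> f - g \<in> cspan tensor_relators"

lemma equivp_tensor_equiv:
  "equivp (tensor_equiv :: (('a::complex_vector \<times> 'b::complex_vector) \<Rightarrow>\<^sub>0 complex) \<Rightarrow> _)"
proof (rule equivpI)
  show "reflp (tensor_equiv :: (('a \<times> 'b) \<Rightarrow>\<^sub>0 complex) \<Rightarrow> _)"
    by (simp add: reflp_def tensor_equiv_def complex_vector.span_zero)
  show "symp (tensor_equiv :: (('a \<times> 'b) \<Rightarrow>\<^sub>0 complex) \<Rightarrow> _)"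
    unfolding symp_def tensor_equiv_def
    by (metis complex_vector.span_neg minus_diff_eq)
  show "transp (tensor_equiv :: (('a \<times> 'b) \<Rightarrow>\<^sub>0 complex) \<Rightarrow> _)"
  proof (rule transpI)
    fix f g h :: "('a \<times> 'b) \<Rightarrow>\<^sub>0 complex"
    assume "tensor_equiv f g" "tensor_equiv g h"
    then have "(f - g) + (g - h) \<in> cspan tensor_relators"
      unfolding tensor_equiv_def by (rule complex_vector.span_add)
    then show "tensor_equiv f h" by (simp add: tensor_equiv_def)
  qed
qed

quotient_type (overloaded) ('a, 'b) tensor =
    "(('a::complex_vector \<times> 'b::complex_vector) \<Rightarrow>\<^sub>0 complex)" / tensor_equiv
  by (rule equivp_tensor_equiv)

instantiation tensor :: (complex_vector, complex_vector) complex_vector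
begin

lift_definition zero_tensor :: "('a, 'b) tensor" is 0 .

lift_definition plus_tensor :: "('a, 'b) tensor \<Rightarrow> ('a, 'b) tensor \<Rightarrow> ('a, 'b) tensor" is "(+)"
proof -
  fix f g f' g' :: "('a \<times> 'b) \<Rightarrow>\<^sub>0 complex"
  assume "tensor_equiv f g" "tensor_equiv f' g'"
  then have "(f - g) + (f' - g') \<in> cspan tensor_relators"
    unfolding tensor_equiv_def by (rule complex_vector.span_add)
  then show "tensor_equiv (f + f') (g + g')"
    unfolding tensor_equiv_def by (simp add: algebra_simps)
qed

lift_definition minus_tensor :: "('a, 'b) tensor \<Rightarrow> ('a, 'b) tensor \<Rightarrow> ('a, 'b) tensor" is "(-)"
proof -
  fix f g f' g' :: "('a \<times> 'b) \<Rightarrow>\<^sub>0 complex"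
  assume "tensor_equiv f g" "tensor_equiv f' g'"
  then have "(f - g) - (f' - g') \<in> cspan tensor_relators"
    unfolding tensor_equiv_def by (rule complex_vector.span_diff)
  then show "tensor_equiv (f - f') (g - g')"
    unfolding tensor_equiv_def by (simp add: algebra_simps)
qed

lift_definition uminus_tensor :: "('a, 'b) tensor \<Rightarrow> ('a, 'b) tensor" is "uminus"
proof -
  fix f g :: "('a \<times> 'b) \<Rightarrow>\<^sub>0 complex"
  assume "tensor_equiv f g"
  then have "- (f - g) \<in> cspan tensor_relators"
    unfolding tensor_equiv_def by (rule complex_vector.span_neg)
  then show "tensor_equiv (- f) (- g)"
    unfolding tensor_equiv_def by (simp add: algebra_simps)
qed

lift_definition scaleC_tensor :: "complex \<Rightarrow> ('a, 'b) tensor \<Rightarrow> ('a, 'b) tensor" is "scaleC"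
proof -
  fix c and f g :: "('a \<times> 'b) \<Rightarrow>\<^sub>0 complex"
  assume "tensor_equiv f g"
  then have "c *\<^sub>C (f - g) \<in> cspan tensor_relators"
    unfolding tensor_equiv_def by (rule complex_vector.span_scale)
  then show "tensor_equiv (c *\<^sub>C f) (c *\<^sub>C g)"
    unfolding tensor_equiv_def by (simp add: complex_vector.scale_right_diff_distrib)
qed

definition scaleR_tensor :: "real \<Rightarrow> ('a, 'b) tensor \<Rightarrow> ('a, 'b) tensor" where
  "scaleR_tensor r t = complex_of_real r *\<^sub>C t"

instance
proof
  fix a b c :: "('a, 'b) tensor" and u v :: complex and r s :: real
  have refl: "tensor_equiv f f" for f :: "('a \<times> 'b) \<Rightarrow>\<^sub>0 complex"
    by (simp add: tensor_equiv_def complex_vector.span_zero)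
  show "a + b + c = a + (b + c)" by transfer (simp add: refl add.assoc)
  show "a + b = b + a" by transfer (simp add: refl add.commute)
  show "0 + a = a" by transfer (simp add: refl)
  show "- a + a = 0" by transfer (simp add: refl)
  show "a - b = a + - b" by transfer (simp add: refl)
  show add: "u *\<^sub>C (a + b) = u *\<^sub>C a + u *\<^sub>C b" for u and a b :: "('a, 'b) tensor"
    by transfer (simp add: refl scaleC_add_right)
  show add': "(u + v) *\<^sub>C a = u *\<^sub>C a + v *\<^sub>C a" for u v and a :: "('a, 'b) tensor"
    by transfer (simp add: refl scaleC_add_left)
  show assoc: "u *\<^sub>C v *\<^sub>C a = (u * v) *\<^sub>C a" for u v and a :: "('a, 'b) tensor"
    by transfer (simp add: refl scaleC_scaleC)
  show one: "1 *\<^sub>C a = a" for a :: "('a, 'b) tensor"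
    by transfer (simp add: refl scaleC_one)
  show "r *\<^sub>R a = complex_of_real r *\<^sub>C a" by (simp add: scaleR_tensor_def)
  show "r *\<^sub>R (a + b) = r *\<^sub>R a + r *\<^sub>R b" by (simp add: scaleR_tensor_def add)
  show "(r + s) *\<^sub>R a = r *\<^sub>R a + s *\<^sub>R a" by (simp add: scaleR_tensor_def add')
  show "r *\<^sub>R s *\<^sub>R a = (r * s) *\<^sub>R a" by (simp add: scaleR_tensor_def assoc)
  show "1 *\<^sub>R a = a" by (simp add: scaleR_tensor_def one)
qed

end

lift_definition tensor_elem :: "'a::complex_vector \<Rightarrow> 'b::complex_vector \<Rightarrow> ('a, 'b) tensor"
  (infixr \<open>\<otimes>\<^sub>C\<close> 70) is "\<lambda>x y. Poly_Mapping.single (x, y) 1" .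

text \<open>The linear map induced by a bilinear map, and the sesquilinear form induced by a form that
  is conjugate-linear in its first two and linear in its last two arguments. Both are computed
  on representatives; independence of the choice is shown below.\<close>

definition tensor_lift ::
    "('a::complex_vector \<Rightarrow> 'b::complex_vector \<Rightarrow> 'c::complex_vector) \<Rightarrow> ('a, 'b) tensor \<Rightarrow> 'c" where
  "tensor_lift \<beta> t = free_lift (\<lambda>(x, y). \<beta> x y) (rep_tensor t)"

definition tensor_sesq ::
    "('a::complex_vector \<Rightarrow> 'b::complex_vector \<Rightarrow> 'a \<Rightarrow> 'b \<Rightarrow> 'c::complex_vector) \<Rightarrow>
     ('a, 'b) tensor \<Rightarrow> ('a, 'b) tensor \<Rightarrow> 'c" where
  "tensor_sesq g s t =
     free_sesq (\<lambda>(x, y) (z, w). g x y z w) (rep_tensor s) (rep_tensor t)"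

definition tensor_map ::
    "('a::complex_vector \<Rightarrow> 'c::complex_vector) \<Rightarrow> ('b::complex_vector \<Rightarrow> 'd::complex_vector) \<Rightarrow>
     ('a, 'b) tensor \<Rightarrow> ('c, 'd) tensor" where
  "tensor_map f g = tensor_lift (\<lambda>x y. f x \<otimes>\<^sub>C g y)"

lemma free_lift_superset:
  assumes "finite K" "Poly_Mapping.keys f \<subseteq> K"
  shows "free_lift g f = (\<Sum>k\<in>K. Poly_Mapping.lookup f k *\<^sub>C g k)"
  unfolding free_lift_def
  by (rule sum.mono_neutral_left) (use assms in \<open>auto simp: in_keys_iff\<close>)

lemma clinearI:
  assumes "\<And>x y. f (x + y) = f x + f y" "\<And>c x. f (c *\<^sub>C x) = c *\<^sub>C f x"
  shows "clinear f"
  by unfold_locales (fact assms)+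

lemma clinear_free_lift: "clinear (free_lift g)"
proof -
  have add: "free_lift g (f + h) = free_lift g f + free_lift g h" for f h
  proof -
    let ?K = "Poly_Mapping.keys f \<union> Poly_Mapping.keys h"
    have "free_lift g (f + h) = (\<Sum>k\<in>?K. Poly_Mapping.lookup (f + h) k *\<^sub>C g k)"
      by (rule free_lift_superset) (auto simp: Poly_Mapping.keys_add)
    also have "\<dots> = (\<Sum>k\<in>?K. Poly_Mapping.lookup f k *\<^sub>C g k) + (\<Sum>k\<in>?K. Poly_Mapping.lookup h k *\<^sub>C g k)"
      by (simp add: lookup_add scaleC_add_left sum.distrib)
    also have "(\<Sum>k\<in>?K. Poly_Mapping.lookup f k *\<^sub>C g k) = free_lift g f"
      by (rule free_lift_superset[symmetric]) auto
    also have "(\<Sum>k\<in>?K. Poly_Mapping.lookup h k *\<^sub>C g k) = free_lift g h"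
      by (rule free_lift_superset[symmetric]) auto
    finally show ?thesis .
  qed
  have scale: "free_lift g (c *\<^sub>C f) = c *\<^sub>C free_lift g f" for c f
  proof -
    have "Poly_Mapping.keys (c *\<^sub>C f) \<subseteq> Poly_Mapping.keys f"
      by (auto simp: in_keys_iff scaleC_complex_def)
    then have "free_lift g (c *\<^sub>C f) = (\<Sum>k\<in>Poly_Mapping.keys f. Poly_Mapping.lookup (c *\<^sub>C f) k *\<^sub>C g k)"
      by (intro free_lift_superset) auto
    then show ?thesis
      by (simp add: free_lift_def complex_vector.scale_sum_right scaleC_scaleC scaleC_complex_def)
  qed
  show ?thesis
    by (intro clinearI add scale)
qed

lemma free_lift_single [simp]: "free_lift g (Poly_Mapping.single k 1) = g k"
  by (simp add: free_lift_def scaleC_one)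

lemma tensor_lift_respects:
  assumes bil: "\<And>y. clinear (\<lambda>x. \<beta> x y)" "\<And>x. clinear (\<beta> x)"
    and eq: "tensor_equiv f g"
  shows "free_lift (\<lambda>(x, y). \<beta> x y) f = free_lift (\<lambda>(x, y). \<beta> x y) g"
proof -
  let ?L = "free_lift (\<lambda>(x, y). \<beta> x y)"
  interpret L: Vector_Spaces.linear scaleC scaleC ?L by (rule clinear_free_lift)
  interpret b1: Vector_Spaces.linear scaleC scaleC "\<lambda>x. \<beta> x y" for y by (rule bil)
  interpret b2: Vector_Spaces.linear scaleC scaleC "\<beta> x" for x by (rule bil)
  have "?L h = 0" if "h \<in> cspan tensor_relators" for h
    using that
  proof (induction rule: complex_vector.span_induct_alt)
    case base
    show ?case by (simp add: L.zero)
  next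
    case (step c r h)
    then have "?L r = 0"
      by (auto simp: tensor_relators_def L.diff L.scale b1.add b1.scale b2.add b2.scale)
    with step show ?case by (simp add: L.add L.scale)
  qed
  then show ?thesis
    using eq by (fastforce simp: tensor_equiv_def L.diff)
qed

lemma tensor_equiv_rep_abs: "tensor_equiv (rep_tensor (abs_tensor f)) f"
  by (rule rep_abs_rsp_left[OF Quotient3_tensor]) (rule equivp_reflp[OF equivp_tensor_equiv])

lemma tensor_lift_abs:
  assumes "\<And>y. clinear (\<lambda>x. \<beta> x y)" "\<And>x. clinear (\<beta> x)"
  shows "tensor_lift \<beta> (abs_tensor f) = free_lift (\<lambda>(x, y). \<beta> x y) f"
  unfolding tensor_lift_def
  by (rule tensor_lift_respects[OF assms tensor_equiv_rep_abs])

theorem tensor_lift_elem: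
  assumes "\<And>y. clinear (\<lambda>x. \<beta> x y)" "\<And>x. clinear (\<beta> x)"
  shows "tensor_lift \<beta> (x \<otimes>\<^sub>C y) = \<beta> x y"
  unfolding tensor_elem.abs_eq by (simp add: tensor_lift_abs[OF assms])

theorem clinear_tensor_lift:
  assumes "\<And>y. clinear (\<lambda>x. \<beta> x y)" "\<And>x. clinear (\<beta> x)"
  shows "clinear (tensor_lift \<beta>)"
proof -
  let ?L = "free_lift (\<lambda>(x, y). \<beta> x y)"
  interpret L: Vector_Spaces.linear scaleC scaleC ?L by (rule clinear_free_lift)
  have add: "tensor_lift \<beta> (s + t) = tensor_lift \<beta> s + tensor_lift \<beta> t" for s t
    by (induct s, induct t)
      (simp only: plus_tensor.abs_eq tensor_lift_abs[OF assms] L.add)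
  have scale: "tensor_lift \<beta> (c *\<^sub>C t) = c *\<^sub>C tensor_lift \<beta> t" for c t
    by (induct t)
      (simp only: scaleC_tensor.abs_eq tensor_lift_abs[OF assms] L.scale)
  show ?thesis
    by (intro clinearI add scale)
qed

lemma free_sesq_conv_right:
  "free_sesq g f h = free_lift (\<lambda>l. \<Sum>k\<in>Poly_Mapping.keys f. cnj (Poly_Mapping.lookup f k) *\<^sub>C g k l) h"
  unfolding free_sesq_def free_lift_def
  by (subst sum.swap)
    (simp add: complex_vector.scale_sum_right scaleC_scaleC mult.commute)

lemma free_sesq_conv_left:
  assumes "finite K" "Poly_Mapping.keys f \<subseteq> K"
  shows "free_sesq g f h = (\<Sum>k\<in>K. cnj (Poly_Mapping.lookup f k) *\<^sub>C free_lift (g k) h)"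
proof -
  have "free_sesq g f h = (\<Sum>k\<in>Poly_Mapping.keys f. cnj (Poly_Mapping.lookup f k) *\<^sub>C free_lift (g k) h)"
    unfolding free_sesq_def free_lift_def
    by (simp add: complex_vector.scale_sum_right scaleC_scaleC)
  also have "\<dots> = (\<Sum>k\<in>K. cnj (Poly_Mapping.lookup f k) *\<^sub>C free_lift (g k) h)"
    by (rule sum.mono_neutral_left) (use assms in \<open>auto simp: in_keys_iff\<close>)
  finally show ?thesis .
qed

lemma free_sesq_add_left: "free_sesq g (f + f') h = free_sesq g f h + free_sesq g f' h"
proof -
  let ?K = "Poly_Mapping.keys f \<union> Poly_Mapping.keys f'"
  have "free_sesq g (f + f') h = (\<Sum>k\<in>?K. cnj (Poly_Mapping.lookup (f + f') k) *\<^sub>C free_lift (g k) h)"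
    by (rule free_sesq_conv_left) (auto simp: Poly_Mapping.keys_add)
  moreover have "free_sesq g f h = (\<Sum>k\<in>?K. cnj (Poly_Mapping.lookup f k) *\<^sub>C free_lift (g k) h)"
    by (rule free_sesq_conv_left) auto
  moreover have "free_sesq g f' h = (\<Sum>k\<in>?K. cnj (Poly_Mapping.lookup f' k) *\<^sub>C free_lift (g k) h)"
    by (rule free_sesq_conv_left) auto
  ultimately show ?thesis
    by (simp add: lookup_add scaleC_add_left sum.distrib)
qed

lemma free_sesq_scale_left: "free_sesq g (c *\<^sub>C f) h = cnj c *\<^sub>C free_sesq g f h"
proof -
  have "free_sesq g (c *\<^sub>C f) h = (\<Sum>k\<in>Poly_Mapping.keys f. cnj (Poly_Mapping.lookup (c *\<^sub>C f) k) *\<^sub>C free_lift (g k) h)"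
    by (rule free_sesq_conv_left) (auto simp: in_keys_iff scaleC_complex_def)
  moreover have "free_sesq g f h = (\<Sum>k\<in>Poly_Mapping.keys f. cnj (Poly_Mapping.lookup f k) *\<^sub>C free_lift (g k) h)"
    by (rule free_sesq_conv_left) auto
  ultimately show ?thesis
    by (simp add: complex_vector.scale_sum_right scaleC_scaleC scaleC_complex_def)
qed

lemma free_sesq_single [simp]:
  "free_sesq g (Poly_Mapping.single k 1) h = free_lift (g k) h"
  by (subst free_sesq_conv_left[of "{k}"]) (simp_all add: scaleC_one)

lemma tensor_sesq_respects:
  assumes l: "\<And>x x' y z w. g (x + x') y z w = g x y z w + g x' y z w"
    "\<And>x y y' z w. g x (y + y') z w = g x y z w + g x y' z w"
    "\<And>c x y z w. g (c *\<^sub>C x) y z w = cnj c *\<^sub>C g x y z w"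
    "\<And>c x y z w. g x (c *\<^sub>C y) z w = cnj c *\<^sub>C g x y z w"
    and r: "\<And>x y w. clinear (\<lambda>z. g x y z w)" "\<And>x y z. clinear (g x y z)"
    and eq: "tensor_equiv f f'" "tensor_equiv h h'"
  shows "free_sesq (\<lambda>(x, y) (z, w). g x y z w) f h = free_sesq (\<lambda>(x, y) (z, w). g x y z w) f' h'"
    (is "?S f h = ?S f' h'")
proof -
  let ?L = "\<lambda>x y h. free_lift (\<lambda>(z, w). g x y z w) h"
  have left: "?L (x + x') y h = ?L x y h + ?L x' y h"
    "?L x (y + y') h = ?L x y h + ?L x y' h"
    "?L (c *\<^sub>C x) y h = cnj c *\<^sub>C ?L x y h" "?L x (c *\<^sub>C y) h = cnj c *\<^sub>C ?L x y h" for x x' y y' c h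
    by (simp_all add: free_lift_def l case_prod_unfold scaleC_add_right sum.distrib
        complex_vector.scale_sum_right scaleC_scaleC mult.commute)
  have diff: "?S (a - b) h = ?S a h - ?S b h" for a b
    using free_sesq_add_left[of "\<lambda>(x, y) (z, w). g x y z w" "a - b" b h] by simp
  have "?S u h = 0" if "u \<in> cspan tensor_relators" for u
    using that
  proof (induction rule: complex_vector.span_induct_alt)
    case base
    show ?case by (simp add: free_sesq_def)
  next
    case (step c r u)
    then have "?S r h = 0"
      by (auto simp: tensor_relators_def diff free_sesq_scale_left left)
    with step show ?case
      by (simp add: free_sesq_add_left free_sesq_scale_left)
  qed
  then have "?S f h = ?S f' h"
    using eq(1) diff[of f f'] by (simp add: tensor_equiv_def)
  also have "\<dots> = ?S f' h'"
  proof -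
    have "?L x y h = ?L x y h'" for x y
      by (rule tensor_lift_respects) (use r eq in auto)
    then show ?thesis
      by (simp add: free_sesq_conv_left[of "Poly_Mapping.keys f'"] case_prod_unfold)
  qed
  finally show ?thesis .
qed

theorem tensor_sesq_elem:
  assumes "\<And>x x' y z w. g (x + x') y z w = g x y z w + g x' y z w"
    "\<And>x y y' z w. g x (y + y') z w = g x y z w + g x y' z w"
    "\<And>c x y z w. g (c *\<^sub>C x) y z w = cnj c *\<^sub>C g x y z w"
    "\<And>c x y z w. g x (c *\<^sub>C y) z w = cnj c *\<^sub>C g x y z w"
    "\<And>x y w. clinear (\<lambda>z. g x y z w)" "\<And>x y z. clinear (g x y z)"
  shows "tensor_sesq g (x \<otimes>\<^sub>C y) (z \<otimes>\<^sub>C w) = g x y z w"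
proof -
  have "tensor_sesq g (x \<otimes>\<^sub>C y) (z \<otimes>\<^sub>C w) =
      free_sesq (\<lambda>(x, y) (z, w). g x y z w)
        (Poly_Mapping.single (x, y) 1) (Poly_Mapping.single (z, w) 1)"
    unfolding tensor_sesq_def tensor_elem.abs_eq
    by (intro tensor_sesq_respects tensor_equiv_rep_abs assms)
  then show ?thesis by simp
qed


section \<open>Correspondences and internal tensor powers\<close>

text \<open>Only the data of a C*-correspondence over \<open>B\<close>; the notions below are applied to the edge
  correspondence, which is a subspace of \<open>B \<otimes>\<^sub>\<psi> B\<close> with the inherited structure.\<close>

record ('b, 'x) correspondence =
  carr :: "'x set"
  cadd :: "'x \<Rightarrow> 'x \<Rightarrow> 'x"
  cscale :: "complex \<Rightarrow> 'x \<Rightarrow> 'x"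
  lact :: "'b \<Rightarrow> 'x \<Rightarrow> 'x"
  ract :: "'x \<Rightarrow> 'b \<Rightarrow> 'x"
  cinner :: "'x \<Rightarrow> 'x \<Rightarrow> 'b"

definition correspondence_iso ::
    "('b, 'x) correspondence \<Rightarrow> ('b, 'y) correspondence \<Rightarrow> bool"  (infix \<open>\<cong>\<^sub>c\<close> 50) where
  "X \<cong>\<^sub>c Y \<longleftrightarrow>
     (\<exists>U. bij_betw U (carr X) (carr Y) \<and>
       (\<forall>x\<in>carr X. \<forall>y\<in>carr X. U (cadd X x y) = cadd Y (U x) (U y)) \<and>
       (\<forall>c. \<forall>x\<in>carr X. U (cscale X c x) = cscale Y c (U x)) \<and>
       (\<forall>a. \<forall>x\<in>carr X. U (lact X a x) = lact Y a (U x)) \<and>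
       (\<forall>b. \<forall>x\<in>carr X. U (ract X x b) = ract Y (U x) b) \<and>
       (\<forall>x\<in>carr X. \<forall>y\<in>carr X. cinner Y (U x) (U y) = cinner X x y))"

definition trivial_correspondence :: "('b::cstar_algebra, 'b) correspondence" where
  "trivial_correspondence =
     \<lparr>carr = UNIV, cadd = (+), cscale = scaleC, lact = (*), ract = (*),
      cinner = (\<lambda>x y. star x * y)\<rparr>"

definition faithful_correspondence :: "('b, 'x) correspondence \<Rightarrow> bool" where
  "faithful_correspondence X \<longleftrightarrow> inj (\<lambda>a. restrict (lact X a) (carr X))"

definition full_correspondence :: "('b::cstar_algebra, 'x) correspondence \<Rightarrow> bool" where
  "full_correspondence X \<longleftrightarrow>
     closure (cspan {cinner X x y | x y. x \<in> carr X \<and> y \<in> carr X}) = UNIV"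

text \<open>For \<open>n \<ge> 1\<close>, \<open>X\<^sup>\<otimes>\<^sup>n\<close> is realised on the free vector space over words \<open>x\<^sub>1 \<dots> x\<^sub>n\<close> in \<open>X\<close>, with
  the \<open>B\<close>-valued semi-inner product determined by
  \<open>\<langle>x\<^sub>1 \<dots> x\<^sub>n | y\<^sub>1 \<dots> y\<^sub>n\<rangle> = \<langle>x\<^sub>n | \<langle>x\<^sub>1 \<dots> x\<^sub>n\<^sub>-\<^sub>1 | y\<^sub>1 \<dots> y\<^sub>n\<^sub>-\<^sub>1\<rangle> \<cdot> y\<^sub>n\<rangle>\<close>,
  modulo the vectors of length zero. Multilinearity and \<open>B\<close>-balancedness hold in the quotient,
  because the corresponding relators have length zero. The quotient is not completed; for
  finite-dimensional \<open>X\<close>, the only case used here, it is finite-dimensional, hence complete.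
  The case \<open>n = 0\<close>, where \<open>X\<^sup>\<otimes>\<^sup>0 = B\<close> by convention, is not covered.\<close>

definition word_space :: "('b, 'x) correspondence \<Rightarrow> nat \<Rightarrow> ('x list \<Rightarrow>\<^sub>0 complex) set" where
  "word_space X n = {f. \<forall>xs\<in>Poly_Mapping.keys f. length xs = n \<and> set xs \<subseteq> carr X}"

text \<open>\<open>word_inner X 1\<close> is the inner product of words; the first argument accumulates the
  inner product of the initial segments already processed.\<close>

fun word_inner :: "('b::cstar_algebra, 'x) correspondence \<Rightarrow> 'b \<Rightarrow> 'x list \<Rightarrow> 'x list \<Rightarrow> 'b" where
  "word_inner X b [] [] = b"
| "word_inner X b (x # xs) (y # ys) = word_inner X (cinner X x (lact X b y)) xs ys"
| "word_inner X b _ _ = 0"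

definition word_lact :: "('b, 'x) correspondence \<Rightarrow> 'b \<Rightarrow> 'x list \<Rightarrow> 'x list" where
  "word_lact X a xs = lact X a (hd xs) # tl xs"

definition word_ract :: "('b, 'x) correspondence \<Rightarrow> 'x list \<Rightarrow> 'b \<Rightarrow> 'x list" where
  "word_ract X xs b = butlast xs @ [ract X (last xs) b]"

definition pre_inner ::
    "('b::cstar_algebra, 'x) correspondence \<Rightarrow> ('x list \<Rightarrow>\<^sub>0 complex) \<Rightarrow> ('x list \<Rightarrow>\<^sub>0 complex) \<Rightarrow> 'b"
  where "pre_inner X = free_sesq (word_inner X 1)"

definition null_rel ::
    "('b::cstar_algebra, 'x) correspondence \<Rightarrow> nat \<Rightarrow>
     (('x list \<Rightarrow>\<^sub>0 complex) \<times> ('x list \<Rightarrow>\<^sub>0 complex)) set" where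
  "null_rel X n =
     {(f, g). f \<in> word_space X n \<and> g \<in> word_space X n \<and> pre_inner X (f - g) (f - g) = 0}"

definition tensor_power ::
    "('b::cstar_algebra, 'x) correspondence \<Rightarrow> nat \<Rightarrow> ('b, ('x list \<Rightarrow>\<^sub>0 complex) set) correspondence"
  where
  "tensor_power X n =
     \<lparr>carr = word_space X n // null_rel X n,
      cadd = (\<lambda>P Q. \<Union>f\<in>P. \<Union>g\<in>Q. null_rel X n `` {f + g}),
      cscale = (\<lambda>c P. \<Union>f\<in>P. null_rel X n `` {c *\<^sub>C f}),
      lact = (\<lambda>a P. \<Union>f\<in>P. null_rel X n ``
        {free_lift (\<lambda>xs. Poly_Mapping.single (word_lact X a xs) 1) f}),
      ract = (\<lambda>P b. \<Union>f\<in>P. null_rel X n ``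
        {free_lift (\<lambda>xs. Poly_Mapping.single (word_ract X xs b) 1) f}),
      cinner = (\<lambda>P Q. the_elem (\<Union>f\<in>P. \<Union>g\<in>Q. {pre_inner X f g}))\<rparr>"

definition periodic :: "('b::cstar_algebra, 'x) correspondence \<Rightarrow> bool" where
  "periodic X \<longleftrightarrow> (\<exists>n\<ge>1. tensor_power X n \<cong>\<^sub>c trivial_correspondence)"


section \<open>Quantum graphs\<close>

definition l2_inner :: "('b::cstar_algebra \<Rightarrow> complex) \<Rightarrow> 'b \<Rightarrow> 'b \<Rightarrow> complex" where
  "l2_inner \<psi> x y = \<psi> (star x * y)"

definition l2_tensor_inner ::
    "('b::cstar_algebra \<Rightarrow> complex) \<Rightarrow> ('b, 'b) tensor \<Rightarrow> ('b, 'b) tensor \<Rightarrow> complex" where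
  "l2_tensor_inner \<psi> = tensor_sesq (\<lambda>x y z w. \<psi> (star x * z) * \<psi> (star y * w))"

definition mult_map :: "('b::cstar_algebra, 'b) tensor \<Rightarrow> 'b" where
  "mult_map = tensor_lift (*)"

text \<open>The Hilbert space adjoint \<open>m\<^sup>*\<close>; for a faithful state on a finite-dimensional algebra it
  exists and is unique.\<close>

definition mult_adj :: "('b::cstar_algebra \<Rightarrow> complex) \<Rightarrow> 'b \<Rightarrow> ('b, 'b) tensor" where
  "mult_adj \<psi> = (THE F. \<forall>x t. l2_tensor_inner \<psi> (F x) t = l2_inner \<psi> x (mult_map t))"

definition delta_form :: "real \<Rightarrow> ('b::cstar_algebra \<Rightarrow> complex) \<Rightarrow> bool" where
  "delta_form \<delta> \<psi> \<longleftrightarrow>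
     \<delta> > 0 \<and> faithful_state \<psi> \<and> (\<forall>x. mult_map (mult_adj \<psi> x) = \<delta>\<^sup>2 *\<^sub>R x)"

definition quantum_schur_idempotent ::
    "real \<Rightarrow> ('b::cstar_algebra \<Rightarrow> complex) \<Rightarrow> ('b \<Rightarrow> 'b) \<Rightarrow> bool" where
  "quantum_schur_idempotent \<delta> \<psi> A \<longleftrightarrow>
     (\<forall>x. mult_map (tensor_map A A (mult_adj \<psi> x)) = \<delta>\<^sup>2 *\<^sub>R A x)"

definition quantum_graph ::
    "real \<Rightarrow> ('b::fin_dim_cstar_algebra \<Rightarrow> complex) \<Rightarrow> ('b \<Rightarrow> 'b) \<Rightarrow> bool" where
  "quantum_graph \<delta> \<psi> A \<longleftrightarrow>
     faithful_state \<psi> \<and> clinear A \<and> quantum_schur_idempotent \<delta> \<psi> A"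

definition quantum_source :: "('b::cstar_algebra \<Rightarrow> 'b) \<Rightarrow> 'b set \<Rightarrow> bool" where
  "quantum_source A S \<longleftrightarrow> central_summand S \<and> S \<noteq> {0} \<and> (\<forall>s\<in>S. A s = 0)"

definition quantum_sink ::
    "('b::cstar_algebra \<Rightarrow> complex) \<Rightarrow> ('b \<Rightarrow> 'b) \<Rightarrow> 'b set \<Rightarrow> bool" where
  "quantum_sink \<psi> A S \<longleftrightarrow>
     central_summand S \<and> S \<noteq> {0} \<and> (\<forall>s\<in>S. \<forall>x. l2_inner \<psi> s (A x) = 0)"

text \<open>The correspondence \<open>B \<otimes>\<^sub>\<psi> B\<close>.\<close>

definition tensor_lact :: "'b::cstar_algebra \<Rightarrow> ('b, 'b) tensor \<Rightarrow> ('b, 'b) tensor" where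
  "tensor_lact a = tensor_map (\<lambda>x. a * x) (\<lambda>y. y)"

definition tensor_ract :: "('b::cstar_algebra, 'b) tensor \<Rightarrow> 'b \<Rightarrow> ('b, 'b) tensor" where
  "tensor_ract t b = tensor_map (\<lambda>x. x) (\<lambda>y. y * b) t"

definition tensor_inner ::
    "('b::cstar_algebra \<Rightarrow> complex) \<Rightarrow> ('b, 'b) tensor \<Rightarrow> ('b, 'b) tensor \<Rightarrow> 'b" where
  "tensor_inner \<psi> = tensor_sesq (\<lambda>x y z w. star y * (\<psi> (star x * z) *\<^sub>C w))"

definition edge_element ::
    "real \<Rightarrow> ('b::cstar_algebra \<Rightarrow> complex) \<Rightarrow> ('b \<Rightarrow> 'b) \<Rightarrow> ('b, 'b) tensor" where
  "edge_element \<delta> \<psi> A = (1 / \<delta>\<^sup>2) *\<^sub>R tensor_map (\<lambda>x. x) A (mult_adj \<psi> 1)"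

definition edge_correspondence ::
    "real \<Rightarrow> ('b::cstar_algebra \<Rightarrow> complex) \<Rightarrow> ('b \<Rightarrow> 'b) \<Rightarrow> ('b, ('b, 'b) tensor) correspondence"
  where
  "edge_correspondence \<delta> \<psi> A =
     \<lparr>carr = cspan {tensor_ract (tensor_lact x (edge_element \<delta> \<psi> A)) y | x y. True},
      cadd = (+), cscale = scaleC, lact = tensor_lact, ract = tensor_ract,
      cinner = tensor_inner \<psi>\<rparr>"

text \<open>The forms above take the intended values on elementary tensors.\<close>

lemma clinear_mult: "clinear ((*) (x :: 'b::cstar_algebra))" "clinear (\<lambda>x. x * (y :: 'b))"
  by (intro clinearI; simp add: algebra_simps mult_scaleC_left mult_scaleC_right)+

lemma clinear_tensor_elem: "clinear (\<lambda>y. x \<otimes>\<^sub>C y)" "clinear (\<lambda>x. x \<otimes>\<^sub>C y)"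
proof -
  note defs = tensor_elem.abs_eq plus_tensor.abs_eq scaleC_tensor.abs_eq tensor.abs_eq_iff
    tensor_equiv_def
  have "x \<otimes>\<^sub>C (y + y') = x \<otimes>\<^sub>C y + x \<otimes>\<^sub>C y'" for y y'
    unfolding defs
    by (rule complex_vector.span_base) (unfold tensor_relators_def diff_diff_eq[symmetric], blast)
  moreover have "x \<otimes>\<^sub>C (c *\<^sub>C y) = c *\<^sub>C (x \<otimes>\<^sub>C y)" for c y
    unfolding defs
    by (rule complex_vector.span_base) (unfold tensor_relators_def, blast)
  ultimately show "clinear (\<lambda>y. x \<otimes>\<^sub>C y)" by (intro clinearI)
  have "(x + x') \<otimes>\<^sub>C y = x \<otimes>\<^sub>C y + x' \<otimes>\<^sub>C y" for x x'
    unfolding defs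
    by (rule complex_vector.span_base) (unfold tensor_relators_def diff_diff_eq[symmetric], blast)
  moreover have "(c *\<^sub>C x) \<otimes>\<^sub>C y = c *\<^sub>C (x \<otimes>\<^sub>C y)" for c x
    unfolding defs
    by (rule complex_vector.span_base) (unfold tensor_relators_def, blast)
  ultimately show "clinear (\<lambda>x. x \<otimes>\<^sub>C y)" by (intro clinearI)
qed

lemma tensor_map_elem:
  fixes f :: "'a::complex_vector \<Rightarrow> 'c::complex_vector"
    and g :: "'b::complex_vector \<Rightarrow> 'd::complex_vector"
  assumes "clinear f" "clinear g"
  shows "tensor_map f g (x \<otimes>\<^sub>C y) = f x \<otimes>\<^sub>C g y"
proof -
  interpret f: Vector_Spaces.linear scaleC scaleC f by fact
  interpret g: Vector_Spaces.linear scaleC scaleC g by fact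
  interpret l: Vector_Spaces.linear scaleC scaleC "\<lambda>y :: 'd. x \<otimes>\<^sub>C y" for x :: 'c
    by (rule clinear_tensor_elem)
  interpret r: Vector_Spaces.linear scaleC scaleC "\<lambda>x :: 'c. x \<otimes>\<^sub>C y" for y :: 'd
    by (rule clinear_tensor_elem)
  show ?thesis
    unfolding tensor_map_def
    by (rule tensor_lift_elem; intro clinearI)
      (simp_all add: f.add f.scale g.add g.scale l.add l.scale r.add r.scale)
qed

lemma tensor_lact_elem: "tensor_lact a (x \<otimes>\<^sub>C y) = (a * x) \<otimes>\<^sub>C y"
  unfolding tensor_lact_def by (rule tensor_map_elem) (auto intro: clinear_mult clinearI)

lemma tensor_ract_elem: "tensor_ract (x \<otimes>\<^sub>C y) b = x \<otimes>\<^sub>C (y * b)"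
  unfolding tensor_ract_def by (rule tensor_map_elem) (auto intro: clinear_mult clinearI)

lemma mult_map_elem: "mult_map (x \<otimes>\<^sub>C y) = x * y"
  unfolding mult_map_def by (rule tensor_lift_elem) (rule clinear_mult)+

lemma
  assumes "clinear \<psi>"
  shows tensor_inner_elem:
      "tensor_inner \<psi> (x \<otimes>\<^sub>C y) (z \<otimes>\<^sub>C w) = star y * (\<psi> (star x * z) *\<^sub>C w)"
    and l2_tensor_inner_elem:
      "l2_tensor_inner \<psi> (x \<otimes>\<^sub>C y) (z \<otimes>\<^sub>C w) = \<psi> (star x * z) * \<psi> (star y * w)"
proof -
  interpret p: Vector_Spaces.linear scaleC scaleC \<psi> by fact
  note lin = p.add p.scale star_add star_scaleC mult_scaleC_left mult_scaleC_right
    distrib_left distrib_right scaleC_add_left scaleC_add_right scaleC_scaleC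
  show "tensor_inner \<psi> (x \<otimes>\<^sub>C y) (z \<otimes>\<^sub>C w) = star y * (\<psi> (star x * z) *\<^sub>C w)"
    unfolding tensor_inner_def
    by (rule tensor_sesq_elem; (intro clinearI)?)
      (simp_all add: lin scaleC_complex_def mult_ac)
  show "l2_tensor_inner \<psi> (x \<otimes>\<^sub>C y) (z \<otimes>\<^sub>C w) = \<psi> (star x * z) * \<psi> (star y * w)"
    unfolding l2_tensor_inner_def
    by (rule tensor_sesq_elem; (intro clinearI)?)
      (simp_all add: lin scaleC_complex_def mult_ac)
qed

end

theory Submission
  imports Defs
begin

text \<open>The implication from periodic to faithful and full is not specific to graphs: the trivial
  correspondence \<open>B\<close> has both properties, and each passes from \<open>X\<^sup>\<otimes>\<^sup>n \<cong> B\<close> down to \<open>X\<close>.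

  Faithfulness: \<open>B\<close> acts on \<open>X\<^sup>\<otimes>\<^sup>n\<close> through the first tensor factor, so elements that act in the same
  way on \<open>X\<close> act in the same way on \<open>X\<^sup>\<otimes>\<^sup>n\<close>, hence on \<open>B\<close>, hence are equal
  (\<open>periodic_imp_faithful\<close>).

  Fullness: the inner product of two words of length \<open>n\<close> ends with an inner product of two vectors
  of \<open>X\<close>, so all inner products of \<open>X\<^sup>\<otimes>\<^sup>n\<close> lie in the span of those of \<open>X\<close>; and in \<open>B\<close> every \<open>b\<close> is
  the inner product of \<open>1\<close> and \<open>b\<close> (\<open>periodic_imp_full\<close>). This needs the inner
  product of classes of words to be that of their representatives, that is, vectors of length zero
  have to be orthogonal to all words. Instead of a Cauchy-Schwarz inequality, coordinates are used:
  an orthonormal basis of \<open>L\<^sup>2(B, \<psi>)\<close> identifies \<open>B \<otimes>\<^sub>\<psi> B\<close>, as a right module, with a finite power of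
  \<open>B\<close>. Hence the inner product of words, too, is a finite sum of terms \<open>star (v i) * w i\<close>
  (\<open>pre_inner_coord\<close>), and a vector of length zero has all its coordinates zero.

  For the graph, let \<open>p\<close> be the projection onto a central summand. In an orthonormal basis \<open>e\<close>,
  \<open>m\<^sup>*(x)\<close> is the sum of the \<open>e \<otimes> star e * x\<close> (\<open>mult_adj_eq\<close>), and it also equals \<open>x \<cdot> m\<^sup>*(1)\<close>
  (\<open>tensor_lact_mult_adj\<close>). So if \<open>A\<close> vanishes on the summand, applying \<open>A\<close> to the second legs of
  \<open>p \<cdot> m\<^sup>*(1) = m\<^sup>*(p)\<close> shows that \<open>p\<close> kills the edge element from the left, and so acts as zero on the
  edge correspondence, which is then not faithful. If the range of \<open>A\<close> is orthogonal to the summand,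
  then \<open>p\<close> kills the edge element from the right, so all inner products are killed by \<open>p\<close>, and
  the edge correspondence is not full.\<close>

section \<open>Elementary tensors and induced forms\<close>

text \<open>Scalars need no case of their own: they are absorbed into the first leg of an elementary tensor.\<close>

lemma tensor_induct [case_names elem add]:
  fixes t :: "('a::complex_vector, 'b::complex_vector) tensor"
  assumes elem: "\<And>x y. P (x \<otimes>\<^sub>C y)"
    and add: "\<And>s t. P s \<Longrightarrow> P t \<Longrightarrow> P (s + t)"
  shows "P t"
proof (induct t)
  fix f :: "('a \<times> 'b) \<Rightarrow>\<^sub>0 complex"
  interpret l: Vector_Spaces.linear scaleC scaleC "\<lambda>x :: 'a. x \<otimes>\<^sub>C (y :: 'b)" for y
    by (rule clinear_tensor_elem)
  have single: "P (abs_tensor (Poly_Mapping.single k c))" for k c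
  proof -
    obtain x y where k: "k = (x, y)" by (cases k)
    have "Poly_Mapping.single k c = c *\<^sub>C Poly_Mapping.single k (1::complex)"
      by (simp add: poly_mapping_eq_iff fun_eq_iff lookup_single scaleC_complex_def when_def)
    then have "abs_tensor (Poly_Mapping.single k c) = (c *\<^sub>C x) \<otimes>\<^sub>C y"
      by (simp add: scaleC_tensor.abs_eq[symmetric] tensor_elem.abs_eq[symmetric] k l.scale)
    then show ?thesis by (simp add: elem)
  qed
  show "P (abs_tensor f)"
  proof (induct f rule: update_induct)
    case const
    (* the induction starts at 0, which is single k 0 for any k *)
    show ?case using single[of undefined 0] by simp
  next
    case (update f a b)
    then have "Poly_Mapping.update a b f = f + Poly_Mapping.single a b"
      by (auto simp: poly_mapping_eq_iff fun_eq_iff lookup_add lookup_update lookup_single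
          in_keys_iff when_def)
    then show ?case using add[OF update(3) single[of a b]] by (simp add: plus_tensor.abs_eq)
  qed
qed

lemma clinear_eq_on_elems:
  fixes f g :: "('a::complex_vector, 'b::complex_vector) tensor \<Rightarrow> 'c::complex_vector"
  assumes "clinear f" "clinear g" "\<And>x y. f (x \<otimes>\<^sub>C y) = g (x \<otimes>\<^sub>C y)"
  shows "f t = g t"
proof -
  interpret f: Vector_Spaces.linear scaleC scaleC f by fact
  interpret g: Vector_Spaces.linear scaleC scaleC g by fact
  show ?thesis
    by (induct t rule: tensor_induct) (simp_all add: assms(3) f.add g.add)
qed

lemma clinear_compose: "clinear f \<Longrightarrow> clinear g \<Longrightarrow> clinear (\<lambda>x. f (g x))"
  using Vector_Spaces.linear_compose[of scaleC scaleC g scaleC f] by (simp add: o_def)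

lemma clinear_id: "clinear (\<lambda>x. x)"
  by (intro clinearI) auto

lemma clinear_tensor_map:
  fixes f :: "'a::complex_vector \<Rightarrow> 'c::complex_vector"
    and g :: "'b::complex_vector \<Rightarrow> 'd::complex_vector"
  assumes "clinear f" "clinear g"
  shows "clinear (tensor_map f g)"
  unfolding tensor_map_def
  by (intro clinear_tensor_lift clinear_compose[OF clinear_tensor_elem(1) assms(2)]
      clinear_compose[OF clinear_tensor_elem(2) assms(1)])

lemma clinear_tensor_lact: "clinear (tensor_lact a)"
  unfolding tensor_lact_def by (intro clinear_tensor_map clinear_mult clinear_id)

lemma clinear_tensor_ract: "clinear (\<lambda>t. tensor_ract t b)"
  unfolding tensor_ract_def by (intro clinear_tensor_map clinear_mult clinear_id)

lemma clinear_mult_map: "clinear mult_map"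
  unfolding mult_map_def by (intro clinear_tensor_lift clinear_mult)

lemma tensor_lact_mult: "tensor_lact a (tensor_lact b t) = tensor_lact (a * b) t"
  by (rule clinear_eq_on_elems)
    (auto intro: clinear_tensor_lact clinear_compose simp: tensor_lact_elem mult.assoc)

lemma tensor_ract_mult: "tensor_ract (tensor_ract t a) b = tensor_ract t (a * b)"
  by (rule clinear_eq_on_elems[where t=t])
    (auto intro: clinear_tensor_ract clinear_compose[OF clinear_tensor_ract]
      simp: tensor_ract_elem mult.assoc)

lemma tensor_lact_ract: "tensor_lact a (tensor_ract t b) = tensor_ract (tensor_lact a t) b"
  by (rule clinear_eq_on_elems[where t=t])
    (auto intro: clinear_tensor_ract clinear_tensor_lact clinear_compose[OF clinear_tensor_ract]
      clinear_compose[OF clinear_tensor_lact]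
      simp: tensor_ract_elem tensor_lact_elem)

lemma tensor_lact_add: "tensor_lact (a + b) t = tensor_lact a t + tensor_lact b t"
proof (induct t rule: tensor_induct)
  case (elem x y)
  interpret l: Vector_Spaces.linear scaleC scaleC "\<lambda>x :: 'a. x \<otimes>\<^sub>C (y :: 'a)" for y
    by (rule clinear_tensor_elem)
  show ?case by (simp add: tensor_lact_elem distrib_right l.add)
next
  case (add s t)
  interpret l: Vector_Spaces.linear scaleC scaleC "tensor_lact c" for c :: 'a
    by (rule clinear_tensor_lact)
  from add show ?case by (simp add: l.add algebra_simps)
qed

context
  fixes g :: "'a::complex_vector \<Rightarrow> 'b::complex_vector \<Rightarrow> 'a \<Rightarrow> 'b \<Rightarrow> 'c::complex_vector"
  assumes g: "\<And>x x' y z w. g (x + x') y z w = g x y z w + g x' y z w"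
    "\<And>x y y' z w. g x (y + y') z w = g x y z w + g x y' z w"
    "\<And>c x y z w. g (c *\<^sub>C x) y z w = cnj c *\<^sub>C g x y z w"
    "\<And>c x y z w. g x (c *\<^sub>C y) z w = cnj c *\<^sub>C g x y z w"
    "\<And>x y w. clinear (\<lambda>z. g x y z w)" "\<And>x y z. clinear (g x y z)"
begin

lemma tensor_sesq_abs:
  "tensor_sesq g (abs_tensor f) (abs_tensor h) = free_sesq (\<lambda>(x, y) (z, w). g x y z w) f h"
  unfolding tensor_sesq_def by (intro tensor_sesq_respects tensor_equiv_rep_abs g)

lemma tensor_sesq_add_left: "tensor_sesq g (s + s') t = tensor_sesq g s t + tensor_sesq g s' t"
  by (induct s, induct s', induct t)
    (simp only: plus_tensor.abs_eq tensor_sesq_abs free_sesq_add_left)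

text \<open>Evaluated on a representative of its left argument, the form is the linear extension of a
  function of its right argument.\<close>

lemma clinear_tensor_sesq: "clinear (tensor_sesq g s)"
  unfolding tensor_sesq_def[abs_def] free_sesq_conv_right
proof (intro clinearI)
  fix t t' c
  let ?L = "\<lambda>f. free_lift (\<lambda>l. \<Sum>k\<in>Poly_Mapping.keys f.
    cnj (Poly_Mapping.lookup f k) *\<^sub>C (\<lambda>(x, y) (z, w). g x y z w) k l)"
  interpret L: Vector_Spaces.linear scaleC scaleC "?L f" for f by (rule clinear_free_lift)
  have eq: "tensor_sesq g (abs_tensor f) (abs_tensor h) = ?L f h" for f h
    by (simp add: tensor_sesq_abs free_sesq_conv_right)
  have "tensor_sesq g s (t + t') = tensor_sesq g s t + tensor_sesq g s t'"
    by (induct s, induct t, induct t') (simp only: plus_tensor.abs_eq eq L.add)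
  moreover have "tensor_sesq g s (c *\<^sub>C t) = c *\<^sub>C tensor_sesq g s t"
    by (induct s, induct t) (simp only: scaleC_tensor.abs_eq eq L.scale)
  ultimately show "?L (rep_tensor s) (rep_tensor (t + t')) = ?L (rep_tensor s) (rep_tensor t) + ?L (rep_tensor s) (rep_tensor t')"
    "?L (rep_tensor s) (rep_tensor (c *\<^sub>C t)) = c *\<^sub>C ?L (rep_tensor s) (rep_tensor t)"
    by (simp_all add: tensor_sesq_def free_sesq_conv_right)
qed

end

lemma
  assumes "clinear \<psi>"
  shows tensor_inner_add_left:
      "tensor_inner \<psi> (s + s') t = tensor_inner \<psi> s t + tensor_inner \<psi> s' t"
    and clinear_tensor_inner: "clinear (tensor_inner \<psi> s)"
    and l2_tensor_inner_add_left:
      "l2_tensor_inner \<psi> (s + s') t = l2_tensor_inner \<psi> s t + l2_tensor_inner \<psi> s' t"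
    and clinear_l2_tensor_inner: "clinear (l2_tensor_inner \<psi> s)"
proof -
  interpret p: Vector_Spaces.linear scaleC scaleC \<psi> by fact
  note lin = p.add p.scale star_add star_scaleC mult_scaleC_left mult_scaleC_right
    distrib_left distrib_right scaleC_add_left scaleC_add_right scaleC_scaleC
  show "tensor_inner \<psi> (s + s') t = tensor_inner \<psi> s t + tensor_inner \<psi> s' t"
    "clinear (tensor_inner \<psi> s)"
    unfolding tensor_inner_def
    by (rule tensor_sesq_add_left clinear_tensor_sesq; (intro clinearI)?;
        simp add: lin scaleC_complex_def mult_ac)+
  show "l2_tensor_inner \<psi> (s + s') t = l2_tensor_inner \<psi> s t + l2_tensor_inner \<psi> s' t"
    "clinear (l2_tensor_inner \<psi> s)"
    unfolding l2_tensor_inner_def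
    by (rule tensor_sesq_add_left clinear_tensor_sesq; (intro clinearI)?;
        simp add: lin scaleC_complex_def mult_ac)+
qed

section \<open>Orthonormal bases for a faithful state\<close>

lemma star_zero [simp]: "star (0 :: 'b::cstar_algebra) = 0"
  using star_add[of "0 :: 'b" 0] by simp

lemma star_sum: "star (\<Sum>i\<in>I. f i) = (\<Sum>i\<in>I. star (f i :: 'b::cstar_algebra))"
  by (induct I rule: infinite_finite_induct) (simp_all add: star_add)

text \<open>Polarisation: the values on \<open>x + y\<close> and \<open>x + \<i>y\<close> are real.\<close>

lemma faithful_state_hermitian:
  fixes \<psi> :: "'b::cstar_algebra \<Rightarrow> complex"
  assumes "faithful_state \<psi>"
  shows "\<psi> (star x * y) = cnj (\<psi> (star y * x))"
proof -
  interpret p: Vector_Spaces.linear scaleC scaleC \<psi>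
    using assms by (simp add: faithful_state_def)
  have re: "Im (\<psi> (star z * z)) = 0" for z
    using assms by (auto simp: faithful_state_def complex_nonneg_Reals_iff)
  have "Im (\<psi> (star x * y)) + Im (\<psi> (star y * x)) = 0"
    using re[of "x + y"] re[of x] re[of y]
    by (simp add: star_add distrib_left distrib_right p.add)
  moreover have "Re (\<psi> (star x * y)) = Re (\<psi> (star y * x))"
    using re[of "x + \<i> *\<^sub>C y"] re[of x] re[of y]
    by (simp add: star_add star_scaleC distrib_left distrib_right left_diff_distrib p.add p.diff
        p.scale mult_scaleC_left mult_scaleC_right scaleC_scaleC scaleC_complex_def)
  ultimately show ?thesis by (simp add: complex_eq_iff)
qed

lemma faithful_state_sum_zero:
  fixes \<psi> :: "'b::cstar_algebra \<Rightarrow> complex" and v :: "'i \<Rightarrow> 'b"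
  assumes "faithful_state \<psi>" "finite I" "\<psi> (\<Sum>i\<in>I. star (v i) * v i) = 0" "i \<in> I"
  shows "v i = 0"
proof -
  interpret p: Vector_Spaces.linear scaleC scaleC \<psi>
    using assms by (simp add: faithful_state_def)
  have pos: "0 \<le> Re (\<psi> (star z * z))" "Im (\<psi> (star z * z)) = 0" for z
    using assms by (auto simp: faithful_state_def complex_nonneg_Reals_iff)
  have "(\<Sum>i\<in>I. Re (\<psi> (star (v i) * v i))) = Re (\<psi> (\<Sum>i\<in>I. star (v i) * v i))"
    by (simp add: p.sum)
  then have "(\<Sum>i\<in>I. Re (\<psi> (star (v i) * v i))) = 0"
    using assms by simp
  then have "Re (\<psi> (star (v i) * v i)) = 0"
    using sum_nonneg_eq_0_iff[of I "\<lambda>i. Re (\<psi> (star (v i) * v i))"] assms pos by auto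
  then have "\<psi> (star (v i) * v i) = 0"
    using pos by (simp add: complex_eq_iff)
  then show ?thesis using assms by (simp add: faithful_state_def)
qed

text \<open>Gram-Schmidt orthonormalisation, by induction on the set to be spanned. Membership of \<open>s\<close> in the
  span is expressed by the expansion of \<open>s\<close> itself, which is the only form in which it is used.\<close>

lemma gram_schmidt:
  fixes \<psi> :: "'b::cstar_algebra \<Rightarrow> complex"
  assumes \<psi>: "faithful_state \<psi>" and "finite S"
  shows "\<exists>E. finite E \<and> (\<forall>e\<in>E. \<forall>f\<in>E. \<psi> (star e * f) = (if e = f then 1 else 0)) \<and>
    (\<forall>s\<in>S. (\<Sum>e\<in>E. \<psi> (star e * s) *\<^sub>C e) = s)"
  using \<open>finite S\<close>
proof (induct S)
  case empty
  show ?case by (intro exI[of _ "{}"]) simp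
next
  case (insert v S)
  interpret p: Vector_Spaces.linear scaleC scaleC \<psi>
    using \<psi> by (simp add: faithful_state_def)
  obtain E where E: "finite E" "\<And>e f. e \<in> E \<Longrightarrow> f \<in> E \<Longrightarrow> \<psi> (star e * f) = (if e = f then 1 else 0)"
    "\<And>s. s \<in> S \<Longrightarrow> (\<Sum>e\<in>E. \<psi> (star e * s) *\<^sub>C e) = s"
    using insert by blast
  define w where "w = v - (\<Sum>e\<in>E. \<psi> (star e * v) *\<^sub>C e)"
  show ?case
  proof (cases "w = 0")
    case True
    then show ?thesis using E by (intro exI[of _ E]) (auto simp: w_def)
  next
    case False
    define r where "r = sqrt (Re (\<psi> (star w * w)))"
    define u where "u = complex_of_real (1 / r) *\<^sub>C w"
    have ww: "0 \<le> Re (\<psi> (star w * w))" "Im (\<psi> (star w * w)) = 0" "\<psi> (star w * w) \<noteq> 0"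
      using \<psi> False by (auto simp: faithful_state_def complex_nonneg_Reals_iff)
    then have r: "r > 0" by (auto simp: r_def complex_eq_iff)
    have r2: "\<psi> (star w * w) = complex_of_real (r * r)"
      using ww by (simp add: r_def complex_eq_iff)
    have ew: "\<psi> (star e * w) = 0" if "e \<in> E" for e
    proof -
      have "\<psi> (star e * w) = \<psi> (star e * v) - (\<Sum>f\<in>E. \<psi> (star f * v) * \<psi> (star e * f))"
        by (simp add: w_def right_diff_distrib p.diff sum_distrib_left p.sum mult_scaleC_right
            p.scale scaleC_complex_def)
      also have "(\<Sum>f\<in>E. \<psi> (star f * v) * \<psi> (star e * f)) =
          (\<Sum>f\<in>E. if f = e then \<psi> (star e * v) else 0)"
        by (intro sum.cong refl) (use E(2) that in auto)
      finally show ?thesis using E(1) that by simp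
    qed
    have eu: "\<psi> (star e * u) = 0" if "e \<in> E" for e
      using ew[OF that] by (simp add: u_def mult_scaleC_right p.scale scaleC_complex_def)
    have ue: "\<psi> (star u * e) = 0" if "e \<in> E" for e
      using eu[OF that] faithful_state_hermitian[OF \<psi>, of u e] by simp
    have uu: "\<psi> (star u * u) = 1"
      using r by (simp add: u_def star_scaleC mult_scaleC_left mult_scaleC_right scaleC_scaleC
          p.scale scaleC_complex_def r2 flip: of_real_mult)
    have uE: "u \<notin> E" using eu uu by force
    have uw: "\<psi> (star u * w) *\<^sub>C u = w"
      using r by (simp add: u_def star_scaleC mult_scaleC_left scaleC_scaleC
          p.scale scaleC_complex_def r2 scaleC_one flip: of_real_mult)
    have "\<psi> (star u * v) = \<psi> (star u * (w + (\<Sum>e\<in>E. \<psi> (star e * v) *\<^sub>C e)))"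
      by (simp add: w_def)
    also have "\<dots> = \<psi> (star u * w)"
      by (simp add: distrib_left p.add sum_distrib_left p.sum mult_scaleC_right p.scale ue
          scaleC_complex_def)
    finally have v: "(\<Sum>e\<in>insert u E. \<psi> (star e * v) *\<^sub>C e) = v"
      using E(1) uE uw by (simp add: w_def)
    have S: "(\<Sum>e\<in>insert u E. \<psi> (star e * s) *\<^sub>C e) = s" if "s \<in> S" for s
    proof -
      have "\<psi> (star u * s) = \<psi> (star u * (\<Sum>e\<in>E. \<psi> (star e * s) *\<^sub>C e))"
        using E(3)[OF that] by simp
      also have "\<dots> = 0"
        by (simp add: sum_distrib_left p.sum mult_scaleC_right p.scale ue scaleC_complex_def)
      finally show ?thesis using E(1) uE E(3)[OF that] by simp
    qed
    show ?thesis
      by (intro exI[of _ "insert u E"])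
        (use E(1) uE E(2) v S eu ue uu in \<open>auto simp del: sum.insert\<close>)
  qed
qed

text \<open>An orthonormal basis of \<open>L\<^sup>2(B, \<psi>)\<close>, described through the expansion of vectors that it provides;
  applied under \<open>\<psi>\<close>, this expansion is Parseval's identity.\<close>

locale state_basis =
  fixes \<psi> :: "'b::cstar_algebra \<Rightarrow> complex" and E :: "'b set"
  assumes state: "faithful_state \<psi>"
    and finite_basis: "finite E"
    and expand: "(\<Sum>e\<in>E. \<psi> (star e * x) *\<^sub>C e) = x"

lemma state_basis_exists:
  fixes \<psi> :: "'b::fin_dim_cstar_algebra \<Rightarrow> complex"
  assumes \<psi>: "faithful_state \<psi>"
  obtains E where "state_basis \<psi> E"
proof -
  interpret p: Vector_Spaces.linear scaleC scaleC \<psi>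
    using \<psi> by (simp add: faithful_state_def)
  obtain S :: "'b set" where S: "finite S" "\<And>x. \<exists>c. x = (\<Sum>s\<in>S. c s *\<^sub>C s)"
    using fin_dim by blast
  obtain E where E: "finite E" "\<And>s. s \<in> S \<Longrightarrow> (\<Sum>e\<in>E. \<psi> (star e * s) *\<^sub>C e) = s"
    using gram_schmidt[OF \<psi> S(1)] by blast
  have "(\<Sum>e\<in>E. \<psi> (star e * x) *\<^sub>C e) = x" for x
  proof -
    obtain c where x: "x = (\<Sum>s\<in>S. c s *\<^sub>C s)" using S(2) by blast
    have "(\<Sum>e\<in>E. \<psi> (star e * x) *\<^sub>C e) = (\<Sum>e\<in>E. \<Sum>s\<in>S. c s *\<^sub>C \<psi> (star e * s) *\<^sub>C e)"
      by (simp add: x sum_distrib_left p.sum mult_scaleC_right p.scale scaleC_complex_def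
          complex_vector.scale_sum_left scaleC_scaleC)
    also have "\<dots> = (\<Sum>s\<in>S. c s *\<^sub>C (\<Sum>e\<in>E. \<psi> (star e * s) *\<^sub>C e))"
      by (subst sum.swap) (simp add: complex_vector.scale_sum_right)
    also have "\<dots> = x" by (simp add: E x)
    finally show ?thesis .
  qed
  then show ?thesis
    using that[of E] \<psi> E(1) by (simp add: state_basis_def)
qed

context state_basis
begin

lemma clinear_state: "clinear \<psi>"
  using state by (simp add: faithful_state_def)

sublocale p: Vector_Spaces.linear scaleC scaleC \<psi>
  by (rule clinear_state)

lemma parseval: "(\<Sum>e\<in>E. \<psi> (x * e) * \<psi> (star e * y)) = \<psi> (x * y)"
proof -
  have "\<psi> (x * y) = \<psi> (x * (\<Sum>e\<in>E. \<psi> (star e * y) *\<^sub>C e))"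
    by (simp add: expand)
  then show ?thesis
    by (simp add: sum_distrib_left p.sum mult_scaleC_right p.scale scaleC_complex_def mult.commute)
qed

text \<open>The component of a tensor along the basis vector \<open>e\<close> in the first leg.\<close>

definition coord :: "'b \<Rightarrow> ('b, 'b) tensor \<Rightarrow> 'b" where
  "coord e = tensor_lift (\<lambda>x y. \<psi> (star e * x) *\<^sub>C y)"

lemma clinear_coord: "clinear (coord e)"
  and coord_elem: "coord e (x \<otimes>\<^sub>C y) = \<psi> (star e * x) *\<^sub>C y"
proof -
  note lin = p.add p.scale mult_scaleC_left mult_scaleC_right
    distrib_left distrib_right scaleC_add_left scaleC_add_right scaleC_scaleC
  show "clinear (coord e)" "coord e (x \<otimes>\<^sub>C y) = \<psi> (star e * x) *\<^sub>C y"
    unfolding coord_def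
    by (rule clinear_tensor_lift tensor_lift_elem; intro clinearI;
        simp add: lin scaleC_complex_def mult_ac)+
qed

sublocale c: Vector_Spaces.linear scaleC scaleC "coord e"
  by (rule clinear_coord)

lemma tensor_expand: "(\<Sum>e\<in>E. e \<otimes>\<^sub>C coord e t) = t"
proof (induct t rule: tensor_induct)
  case (elem x y)
  interpret r: Vector_Spaces.linear scaleC scaleC "\<lambda>v :: 'b. (u :: 'b) \<otimes>\<^sub>C v" for u
    by (rule clinear_tensor_elem)
  interpret l: Vector_Spaces.linear scaleC scaleC "\<lambda>u :: 'b. u \<otimes>\<^sub>C (v :: 'b)" for v
    by (rule clinear_tensor_elem)
  have "(\<Sum>e\<in>E. e \<otimes>\<^sub>C coord e (x \<otimes>\<^sub>C y)) = (\<Sum>e\<in>E. \<psi> (star e * x) *\<^sub>C e) \<otimes>\<^sub>C y"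
    by (simp add: coord_elem r.scale l.scale l.sum)
  then show ?case by (simp add: expand)
next
  case (add s t)
  interpret r: Vector_Spaces.linear scaleC scaleC "\<lambda>v :: 'b. (u :: 'b) \<otimes>\<^sub>C v" for u
    by (rule clinear_tensor_elem)
  from add show ?case by (simp add: c.add r.add sum.distrib)
qed

text \<open>Parseval's identity in the first leg makes \<open>B \<otimes>\<^sub>\<psi> B\<close> a finite power of the right module \<open>B\<close>.\<close>

lemma tensor_inner_coord: "tensor_inner \<psi> s t = (\<Sum>e\<in>E. star (coord e s) * coord e t)"
proof (induct s rule: tensor_induct)
  case (elem x y)
  show ?case
  proof (induct t rule: tensor_induct)
    case (elem z w)
    have "(\<Sum>e\<in>E. star (coord e (x \<otimes>\<^sub>C y)) * coord e (z \<otimes>\<^sub>C w)) =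
        (\<Sum>e\<in>E. \<psi> (star x * e) * \<psi> (star e * z)) *\<^sub>C (star y * w)"
      by (simp add: coord_elem star_scaleC mult_scaleC_left mult_scaleC_right scaleC_scaleC
          complex_vector.scale_sum_left faithful_state_hermitian[OF state, of x] mult.commute)
    then show ?case
      by (simp add: parseval tensor_inner_elem[OF clinear_state] mult_scaleC_right)
  next
    case (add t t')
    interpret i: Vector_Spaces.linear scaleC scaleC "tensor_inner \<psi> s" for s
      by (rule clinear_tensor_inner[OF clinear_state])
    from add show ?case by (simp add: i.add c.add distrib_left sum.distrib)
  qed
next
  case (add s s')
  then show ?case
    by (simp add: tensor_inner_add_left[OF clinear_state] c.add star_add distrib_right sum.distrib)
qed

lemma l2_tensor_inner_eq: "l2_tensor_inner \<psi> s t = \<psi> (tensor_inner \<psi> s t)"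
proof (induct s rule: tensor_induct)
  case (elem x y)
  show ?case
  proof (rule clinear_eq_on_elems[where t=t])
    show "clinear (l2_tensor_inner \<psi> (x \<otimes>\<^sub>C y))"
      by (rule clinear_l2_tensor_inner[OF clinear_state])
    show "clinear (\<lambda>t. \<psi> (tensor_inner \<psi> (x \<otimes>\<^sub>C y) t))"
      by (rule clinear_compose[OF clinear_state clinear_tensor_inner[OF clinear_state]])
  qed (simp add: tensor_inner_elem[OF clinear_state] l2_tensor_inner_elem[OF clinear_state]
      mult_scaleC_right p.scale scaleC_complex_def)
next
  case (add s s')
  then show ?case
    by (simp add: tensor_inner_add_left[OF clinear_state] l2_tensor_inner_add_left[OF clinear_state]
        p.add)
qed

section \<open>The adjoint of the multiplication map\<close>

text \<open>Definiteness gives the uniqueness of the adjoint \<open>m\<^sup>*\<close>.\<close>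

lemma l2_tensor_inner_definite:
  assumes "l2_tensor_inner \<psi> s s = 0"
  shows "s = 0"
proof -
  interpret r: Vector_Spaces.linear scaleC scaleC "\<lambda>y :: 'b. (x :: 'b) \<otimes>\<^sub>C y" for x
    by (rule clinear_tensor_elem)
  have "\<psi> (\<Sum>e\<in>E. star (coord e s) * coord e s) = 0"
    using assms by (simp add: l2_tensor_inner_eq tensor_inner_coord)
  then have "coord e s = 0" if "e \<in> E" for e
    using that by (rule faithful_state_sum_zero[OF state finite_basis])
  then show ?thesis
    using tensor_expand[of s] by (simp add: r.zero)
qed

text \<open>On elementary tensors, the inner product of the right-hand side with \<open>z \<otimes> w\<close> is
  \<open>\<psi> (star x * z * w)\<close>, by expanding \<open>z\<close> in the basis.\<close>

lemma mult_adj_eq: "mult_adj \<psi> x = (\<Sum>e\<in>E. e \<otimes>\<^sub>C (star e * x))"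
proof -
  let ?F = "\<lambda>x. \<Sum>e\<in>E. e \<otimes>\<^sub>C (star e * x)"
  let ?P = "\<lambda>F. \<forall>x t. l2_tensor_inner \<psi> (F x) t = l2_inner \<psi> x (mult_map t)"
  have zero: "l2_tensor_inner \<psi> 0 t = 0" for t
    using l2_tensor_inner_add_left[OF clinear_state, of 0 0 t] by simp
  have sum: "l2_tensor_inner \<psi> (\<Sum>i\<in>I. f i) t = (\<Sum>i\<in>I. l2_tensor_inner \<psi> (f i) t)"
    for I :: "'b set" and f t
    by (induct I rule: infinite_finite_induct)
      (simp_all add: zero l2_tensor_inner_add_left[OF clinear_state])
  have F: "?P ?F"
  proof (intro allI)
    fix x t
    show "l2_tensor_inner \<psi> (?F x) t = l2_inner \<psi> x (mult_map t)"
      unfolding l2_inner_def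
    proof (rule clinear_eq_on_elems[where t=t])
      show "clinear (l2_tensor_inner \<psi> (?F x))"
        by (rule clinear_l2_tensor_inner[OF clinear_state])
      show "clinear (\<lambda>t. \<psi> (star x * mult_map t))"
        by (intro clinear_compose[OF clinear_state] clinear_compose[OF clinear_mult(1)]
            clinear_mult_map)
      fix z w
      have "l2_tensor_inner \<psi> (?F x) (z \<otimes>\<^sub>C w) =
          (\<Sum>e\<in>E. \<psi> (star x * ((\<psi> (star e * z) *\<^sub>C e) * w)))"
        by (simp add: sum l2_tensor_inner_elem[OF clinear_state] star_mult star_star
            mult_scaleC_left mult_scaleC_right p.scale scaleC_complex_def mult.assoc)
      also have "\<dots> = \<psi> (star x * ((\<Sum>e\<in>E. \<psi> (star e * z) *\<^sub>C e) * w))"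
        by (simp only: p.sum sum_distrib_left sum_distrib_right)
      finally show "l2_tensor_inner \<psi> (?F x) (z \<otimes>\<^sub>C w) = \<psi> (star x * mult_map (z \<otimes>\<^sub>C w))"
        by (simp add: expand mult_map_elem)
    qed
  qed
  have "G = ?F" if "?P G" for G
  proof
    fix x
    have "l2_tensor_inner \<psi> (G x - ?F x) t = 0" for t
      using l2_tensor_inner_add_left[OF clinear_state, of "G x - ?F x" "?F x" t] that F by simp
    then have "G x - ?F x = 0" by (intro l2_tensor_inner_definite)
    then show "G x = ?F x" by simp
  qed
  then have "mult_adj \<psi> = ?F"
    unfolding mult_adj_def using F by (intro the_equality)
  then show ?thesis by simp
qed

text \<open>The adjoint \<open>m\<^sup>*\<close> is left as well as right \<open>B\<close>-linear: the component of \<open>a \<cdot> m\<^sup>*(1)\<close> along \<open>f\<close> is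
  the adjoint of the expansion of \<open>star a * f\<close>.\<close>

lemma tensor_lact_mult_adj: "tensor_lact a (mult_adj \<psi> 1) = mult_adj \<psi> a"
proof -
  interpret r: Vector_Spaces.linear scaleC scaleC "\<lambda>y :: 'b. (x :: 'b) \<otimes>\<^sub>C y" for x
    by (rule clinear_tensor_elem)
  interpret la: Vector_Spaces.linear scaleC scaleC "tensor_lact c" for c :: 'b
    by (rule clinear_tensor_lact)
  have coord: "coord f (tensor_lact a (mult_adj \<psi> 1)) = star f * a" for f
  proof -
    have "coord f (tensor_lact a (mult_adj \<psi> 1)) = (\<Sum>e\<in>E. \<psi> (star f * (a * e)) *\<^sub>C star e)"
      by (simp add: mult_adj_eq la.sum tensor_lact_elem c.sum coord_elem)
    also have "\<dots> = star (\<Sum>e\<in>E. \<psi> (star e * (star a * f)) *\<^sub>C e)"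
      by (simp add: star_sum star_scaleC flip: faithful_state_hermitian[OF state])
        (simp add: star_mult star_star mult.assoc flip: faithful_state_hermitian[OF state])
    finally show ?thesis by (simp add: expand star_mult star_star)
  qed
  have "(\<Sum>e\<in>E. e \<otimes>\<^sub>C coord e (tensor_lact a (mult_adj \<psi> 1))) = mult_adj \<psi> a"
    by (simp only: coord mult_adj_eq[of a])
  then show ?thesis by (simp only: tensor_expand)
qed

section \<open>Central elements that annihilate the edge correspondence\<close>

lemma cspan_image_zero:
  assumes "clinear f" "\<And>s. s \<in> S \<Longrightarrow> f s = 0" "t \<in> cspan S"
  shows "f t = 0"
proof -
  interpret f: Vector_Spaces.linear scaleC scaleC f by fact
  from assms(3) show ?thesis
    by (induct rule: complex_vector.span_induct_alt) (simp_all add: f.add f.scale f.zero assms(2))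
qed

lemma edge_element_eq:
  assumes "clinear A"
  shows "edge_element \<delta> \<psi> A = (1 / \<delta>\<^sup>2) *\<^sub>R (\<Sum>e\<in>E. e \<otimes>\<^sub>C A (star e))"
proof -
  interpret m: Vector_Spaces.linear scaleC scaleC "tensor_map (\<lambda>x. x) A"
    by (rule clinear_tensor_map[OF clinear_id assms])
  show ?thesis
    by (simp add: edge_element_def mult_adj_eq m.sum tensor_map_elem[OF clinear_id assms])
qed

text \<open>Left multiplication by \<open>p\<close> passes through \<open>id \<otimes> A\<close> to give \<open>m\<^sup>*(p)\<close>, whose second legs are
  multiples of \<open>p\<close> and so lie in the kernel of \<open>A\<close>. Centrality of \<open>p\<close> carries this from the edge
  element to the bimodule it generates.\<close>

lemma source_annihilates_edges:
  assumes A: "clinear A" and central: "\<And>x. p * x = x * p" and source: "\<And>x. A (p * x) = 0"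
    and t: "t \<in> carr (edge_correspondence \<delta> \<psi> A)"
  shows "tensor_lact p t = 0"
proof -
  interpret la: Vector_Spaces.linear scaleC scaleC "tensor_lact c" for c :: 'b
    by (rule clinear_tensor_lact)
  interpret ra: Vector_Spaces.linear scaleC scaleC "\<lambda>t. tensor_ract t c" for c :: 'b
    by (rule clinear_tensor_ract)
  interpret r: Vector_Spaces.linear scaleC scaleC "\<lambda>v :: 'b. (u :: 'b) \<otimes>\<^sub>C v" for u
    by (rule clinear_tensor_elem)
  interpret m: Vector_Spaces.linear scaleC scaleC "tensor_map (\<lambda>x. x) A"
    by (rule clinear_tensor_map[OF clinear_id A])
  have "tensor_lact p (tensor_map (\<lambda>x. x) A u) = tensor_map (\<lambda>x. x) A (tensor_lact p u)" for u
    by (rule clinear_eq_on_elems[where t=u])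
      (auto intro!: clinear_compose[OF clinear_tensor_lact] clinear_tensor_map clinear_id A
        clinear_compose[OF _ clinear_tensor_lact]
        simp: tensor_map_elem[OF clinear_id A] tensor_lact_elem)
  then have "tensor_lact p (tensor_map (\<lambda>x. x) A (mult_adj \<psi> 1)) =
      tensor_map (\<lambda>x. x) A (mult_adj \<psi> p)"
    by (simp add: tensor_lact_mult_adj)
  also have "\<dots> = (\<Sum>e\<in>E. e \<otimes>\<^sub>C A (p * star e))"
    by (simp add: mult_adj_eq m.sum tensor_map_elem[OF clinear_id A] central)
  finally have "tensor_lact p (edge_element \<delta> \<psi> A) = 0"
    by (simp add: edge_element_def scaleR_scaleC la.scale source r.zero)
  then have "tensor_lact p (tensor_ract (tensor_lact x (edge_element \<delta> \<psi> A)) y) = 0" for x y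
    by (simp add: tensor_lact_ract tensor_lact_mult central)
      (simp add: tensor_lact_mult[symmetric] la.zero ra.zero)
  then show ?thesis
    using t by (intro cspan_image_zero[OF clinear_tensor_lact, where t=t])
      (auto simp: edge_correspondence_def)
qed

lemma edges_annihilate_sink:
  assumes A: "clinear A" and central: "\<And>x. p * x = x * p" and sink: "\<And>x. A x * p = 0"
    and t: "t \<in> carr (edge_correspondence \<delta> \<psi> A)"
  shows "tensor_ract t p = 0"
proof -
  interpret la: Vector_Spaces.linear scaleC scaleC "tensor_lact c" for c :: 'b
    by (rule clinear_tensor_lact)
  interpret ra: Vector_Spaces.linear scaleC scaleC "\<lambda>t. tensor_ract t c" for c :: 'b
    by (rule clinear_tensor_ract)
  interpret r: Vector_Spaces.linear scaleC scaleC "\<lambda>v :: 'b. (u :: 'b) \<otimes>\<^sub>C v" for u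
    by (rule clinear_tensor_elem)
  have "tensor_ract (edge_element \<delta> \<psi> A) p = 0"
    by (simp add: edge_element_eq[OF A] scaleR_scaleC ra.scale ra.sum tensor_ract_elem sink r.zero)
  then have "tensor_ract (tensor_ract (tensor_lact x (edge_element \<delta> \<psi> A)) y) p = 0" for x y
    by (simp add: tensor_ract_mult flip: central)
      (simp add: tensor_ract_mult[symmetric] tensor_lact_ract[symmetric] la.zero ra.zero)
  then show ?thesis
    using t by (intro cspan_image_zero[OF clinear_tensor_ract, where t=t])
      (auto simp: edge_correspondence_def)
qed

lemma tensor_inner_ract: "tensor_inner \<psi> s (tensor_ract t b) = tensor_inner \<psi> s t * b"
proof -
  have "coord e (tensor_ract t b) = coord e t * b" for e
    by (rule clinear_eq_on_elems[where t=t])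
      (auto intro!: clinear_compose[OF clinear_coord] clinear_tensor_ract
        clinear_compose[OF clinear_mult(2) clinear_coord]
        simp: coord_elem tensor_ract_elem mult_scaleC_left)
  then show ?thesis
    by (simp add: tensor_inner_coord sum_distrib_right mult.assoc)
qed

end

section \<open>Tensor powers of a correspondence with coordinates\<close>

text \<open>A correspondence whose vectors \<open>x\<close>, acted upon by \<open>a\<close>, have coordinates \<open>\<kappa> i a x\<close> in \<open>B\<close> that
  determine the inner product. The last assumption combines two facts, that the inner product is the
  sum over coordinates and that \<open>star a\<close> acts as the adjoint of \<open>a\<close>, in the form in which they occur
  when the inner product of words is computed from left to right.\<close>

locale coordinatised =
  fixes X :: "('b::cstar_algebra, 'x) correspondence" and \<psi> :: "'b \<Rightarrow> complex"
    and I :: "'i set" and \<kappa> :: "'i \<Rightarrow> 'b \<Rightarrow> 'x \<Rightarrow> 'b"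
  assumes state: "faithful_state \<psi>"
    and finite_index: "finite I"
    and lact_closed: "x \<in> carr X \<Longrightarrow> lact X a x \<in> carr X"
    and inner_lact_add: "x \<in> carr X \<Longrightarrow> y \<in> carr X \<Longrightarrow>
      cinner X x (lact X (a + b) y) = cinner X x (lact X a y) + cinner X x (lact X b y)"
    and inner_coord: "x \<in> carr X \<Longrightarrow> y \<in> carr X \<Longrightarrow>
      cinner X x (lact X (star a * b) y) = (\<Sum>i\<in>I. star (\<kappa> i a x) * \<kappa> i b y)"
begin

text \<open>The coordinate of each letter becomes the element of \<open>B\<close> that acts on the next letter. The default
  value only matters for a pair of empty words.\<close>

fun word_coord :: "'b \<Rightarrow> 'i list \<Rightarrow> 'x list \<Rightarrow> 'b" where
  "word_coord a (i # is) (x # xs) = word_coord (\<kappa> i a x) is xs"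
| "word_coord a _ _ = a"

definition index_words :: "nat \<Rightarrow> 'i list set" where
  "index_words n = {is. set is \<subseteq> I \<and> length is = n}"

lemma finite_index_words: "finite (index_words n)"
  unfolding index_words_def by (rule finite_lists_length_eq[OF finite_index])

lemma sum_index_words_Suc:
  "(\<Sum>is\<in>index_words (Suc n). f is) = (\<Sum>i\<in>I. \<Sum>is\<in>index_words n. f (i # is))"
proof -
  have "(\<Sum>is\<in>index_words (Suc n). f is) = (\<Sum>(is, i)\<in>index_words n \<times> I. f (i # is))"
    unfolding index_words_def lists_length_Suc_eq
    by (subst sum.reindex) (auto simp: inj_on_def case_prod_unfold)
  also have "\<dots> = (\<Sum>is\<in>index_words n. \<Sum>i\<in>I. f (i # is))"
    by (rule sum.cartesian_product[symmetric])
  also have "\<dots> = (\<Sum>i\<in>I. \<Sum>is\<in>index_words n. f (i # is))"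
    by (rule sum.swap)
  finally show ?thesis .
qed

lemma word_inner_add:
  assumes "length xs = length ys" "set xs \<subseteq> carr X" "set ys \<subseteq> carr X"
  shows "word_inner X (a + b) xs ys = word_inner X a xs ys + word_inner X b xs ys"
  using assms by (induct xs ys arbitrary: a b rule: list_induct2) (simp_all add: inner_lact_add)

lemma word_inner_zero:
  assumes "length xs = length ys" "set xs \<subseteq> carr X" "set ys \<subseteq> carr X"
  shows "word_inner X 0 xs ys = 0"
  using word_inner_add[OF assms, of 0 0] by simp

lemma word_inner_sum:
  assumes "length xs = length ys" "set xs \<subseteq> carr X" "set ys \<subseteq> carr X"
  shows "word_inner X (\<Sum>i\<in>J. f i) xs ys = (\<Sum>i\<in>J. word_inner X (f i) xs ys)"
  by (induct J rule: infinite_finite_induct)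
    (simp_all add: word_inner_zero[OF assms] word_inner_add[OF assms])

text \<open>If the accumulated inner product has the form \<open>star a * b\<close>, then one more letter turns it into a sum
  of terms of this form.\<close>

lemma word_inner_coord:
  assumes "length xs = length ys" "set xs \<subseteq> carr X" "set ys \<subseteq> carr X"
  shows "word_inner X (star a * b) xs ys =
    (\<Sum>is\<in>index_words (length xs). star (word_coord a is xs) * word_coord b is ys)"
  using assms
proof (induct xs ys arbitrary: a b rule: list_induct2)
  case Nil
  have "index_words 0 = {[]}" by (auto simp: index_words_def)
  then show ?case by simp
next
  case (Cons x xs y ys)
  then show ?case
    by (simp add: inner_coord word_inner_sum sum_index_words_Suc)
qed

definition vec_coord :: "'i list \<Rightarrow> ('x list \<Rightarrow>\<^sub>0 complex) \<Rightarrow> 'b" where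
  "vec_coord is = free_lift (word_coord 1 is)"

lemma star_one: "star (1 :: 'b) = 1"
  by (metis mult_1_right star_mult star_star)

lemma pre_inner_coord:
  assumes f: "f \<in> word_space X n" and g: "g \<in> word_space X n"
  shows "pre_inner X f g = (\<Sum>is\<in>index_words n. star (vec_coord is f) * vec_coord is g)"
proof -
  let ?c = "Poly_Mapping.lookup f" and ?d = "Poly_Mapping.lookup g"
  let ?F = "Poly_Mapping.keys f" and ?G = "Poly_Mapping.keys g"
  have "pre_inner X f g = (\<Sum>xs\<in>?F. \<Sum>ys\<in>?G. (cnj (?c xs) * ?d ys) *\<^sub>C
      (\<Sum>is\<in>index_words n. star (word_coord 1 is xs) * word_coord 1 is ys))"
    unfolding pre_inner_def free_sesq_def
  proof (intro sum.cong refl arg_cong[where f="scaleC _"])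
    fix xs ys assume "xs \<in> ?F" "ys \<in> ?G"
    then have "length xs = n" "length ys = n" "set xs \<subseteq> carr X" "set ys \<subseteq> carr X"
      using f g by (auto simp: word_space_def)
    then show "word_inner X 1 xs ys =
        (\<Sum>is\<in>index_words n. star (word_coord 1 is xs) * word_coord 1 is ys)"
      using word_inner_coord[of xs ys 1 1] by (simp add: star_one)
  qed
  also have "\<dots> = (\<Sum>xs\<in>?F. \<Sum>is\<in>index_words n. \<Sum>ys\<in>?G. (cnj (?c xs) * ?d ys) *\<^sub>C
      (star (word_coord 1 is xs) * word_coord 1 is ys))"
    unfolding complex_vector.scale_sum_right by (intro sum.cong refl sum.swap)
  also have "\<dots> = (\<Sum>is\<in>index_words n. \<Sum>xs\<in>?F. \<Sum>ys\<in>?G. (cnj (?c xs) * ?d ys) *\<^sub>C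
      (star (word_coord 1 is xs) * word_coord 1 is ys))"
    by (rule sum.swap)
  also have "\<dots> = (\<Sum>is\<in>index_words n. star (vec_coord is f) * vec_coord is g)"
    by (simp add: vec_coord_def free_lift_def star_sum star_scaleC sum_product mult_scaleC_left
        mult_scaleC_right scaleC_scaleC mult.commute)
  finally show ?thesis .
qed

lemma word_space_diff:
  "f \<in> word_space X n \<Longrightarrow> g \<in> word_space X n \<Longrightarrow> f - g \<in> word_space X n"
  using keys_diff[of f g] by (auto simp: word_space_def)

text \<open>A vector of length zero has vanishing coordinates, as \<open>\<psi>\<close> is faithful.\<close>

lemma null_rel_coord_eq:
  assumes "(f, g) \<in> null_rel X n" "is \<in> index_words n"
  shows "vec_coord is f = vec_coord is g"
proof -
  interpret v: Vector_Spaces.linear scaleC scaleC "vec_coord js" for js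
    unfolding vec_coord_def by (rule clinear_free_lift)
  interpret p: Vector_Spaces.linear scaleC scaleC \<psi>
    using state by (simp add: faithful_state_def)
  have "f - g \<in> word_space X n" "pre_inner X (f - g) (f - g) = 0"
    using assms by (auto simp: null_rel_def intro: word_space_diff)
  then have "\<psi> (\<Sum>is\<in>index_words n. star (vec_coord is (f - g)) * vec_coord is (f - g)) = 0"
    using pre_inner_coord[of "f - g" n "f - g"] by (simp add: p.zero)
  then have "vec_coord is (f - g) = 0"
    using assms(2)
    by (rule faithful_state_sum_zero[OF state finite_index_words])
  then show ?thesis by (simp add: v.diff)
qed

lemma null_rel_inner_eq:
  assumes "(f, f') \<in> null_rel X n" "(g, g') \<in> null_rel X n"
  shows "pre_inner X f' g' = pre_inner X f g"
proof -
  have "f \<in> word_space X n" "f' \<in> word_space X n" "g \<in> word_space X n" "g' \<in> word_space X n"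
    using assms by (auto simp: null_rel_def)
  then show ?thesis
    using null_rel_coord_eq[OF assms(1)] null_rel_coord_eq[OF assms(2)]
    by (simp add: pre_inner_coord)
qed

text \<open>The union that defines the inner product of two classes is a singleton.\<close>

lemma tensor_power_inner:
  assumes f: "f \<in> word_space X n" and g: "g \<in> word_space X n"
  shows "cinner (tensor_power X n) (null_rel X n `` {f}) (null_rel X n `` {g}) = pre_inner X f g"
proof -
  have refl: "(h, h) \<in> null_rel X n" if "h \<in> word_space X n" for h
    using that by (simp add: null_rel_def pre_inner_def free_sesq_def)
  have "(\<Union>f'\<in>null_rel X n `` {f}. \<Union>g'\<in>null_rel X n `` {g}. {pre_inner X f' g'}) =
      {pre_inner X f g}"
    using refl[OF f] refl[OF g] null_rel_inner_eq[of f _ n g] by blast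
  then show ?thesis by (simp add: tensor_power_def)
qed

text \<open>The inner product of two words is that of their last letters, one of them acted upon by what the
  preceding letters have accumulated.\<close>

lemma word_inner_in_inner:
  assumes "length xs = length ys" "xs \<noteq> []" "set xs \<subseteq> carr X" "set ys \<subseteq> carr X"
  shows "\<exists>x\<in>carr X. \<exists>y\<in>carr X. word_inner X a xs ys = cinner X x y"
  using assms
proof (induct xs ys arbitrary: a rule: list_induct2)
  case (Cons x xs y ys)
  show ?case
  proof (cases "xs = []")
    case True
    with Cons show ?thesis by (auto intro!: bexI lact_closed)
  next
    case False
    with Cons show ?thesis by simp
  qed
qed simp

lemma pre_inner_in_inner_span:
  assumes "n \<ge> 1" "f \<in> word_space X n" "g \<in> word_space X n"
  shows "pre_inner X f g \<in> cspan {cinner X x y | x y. x \<in> carr X \<and> y \<in> carr X}"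
  unfolding pre_inner_def free_sesq_def
proof (intro complex_vector.span_sum complex_vector.span_scale complex_vector.span_base)
  fix xs ys assume "xs \<in> Poly_Mapping.keys f" "ys \<in> Poly_Mapping.keys g"
  then have "length xs = n" "length ys = n" "set xs \<subseteq> carr X" "set ys \<subseteq> carr X"
    using assms by (auto simp: word_space_def)
  then show "word_inner X 1 xs ys \<in> {cinner X x y | x y. x \<in> carr X \<and> y \<in> carr X}"
    using word_inner_in_inner[of xs ys 1] assms(1) by fastforce
qed

lemma periodic_imp_full:
  assumes "periodic X"
  shows "full_correspondence X"
proof -
  let ?J = "cspan {cinner X x y | x y. x \<in> carr X \<and> y \<in> carr X}"
  obtain n U where n: "n \<ge> 1" and U: "bij_betw U (carr (tensor_power X n)) UNIV"
    "\<And>P Q. P \<in> carr (tensor_power X n) \<Longrightarrow> Q \<in> carr (tensor_power X n) \<Longrightarrow>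
      star (U P) * U Q = cinner (tensor_power X n) P Q"
    using assms
    by (auto simp: periodic_def correspondence_iso_def trivial_correspondence_def)
  have ex: "\<exists>f\<in>word_space X n. null_rel X n `` {f} \<in> carr (tensor_power X n) \<and>
      U (null_rel X n `` {f}) = b" for b
  proof -
    obtain P where P: "P \<in> carr (tensor_power X n)" "U P = b"
      using U(1) by (metis UNIV_I bij_betw_def imageE)
    from P(1) obtain f where "f \<in> word_space X n" "P = null_rel X n `` {f}"
      by (auto simp: tensor_power_def elim: quotientE)
    with P show ?thesis by auto
  qed
  (* b is the inner product of 1 and b in the trivial correspondence *)
  have "b \<in> ?J" for b
  proof -
    obtain f g where f: "f \<in> word_space X n" "null_rel X n `` {f} \<in> carr (tensor_power X n)"
        "U (null_rel X n `` {f}) = 1"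
      and g: "g \<in> word_space X n" "null_rel X n `` {g} \<in> carr (tensor_power X n)"
        "U (null_rel X n `` {g}) = b"
      using ex[of 1] ex[of b] by blast
    have "b = pre_inner X f g"
      using U(2)[OF f(2) g(2)] f(3) g(3) by (simp add: star_one tensor_power_inner f(1) g(1))
    then show ?thesis using pre_inner_in_inner_span[OF n f(1) g(1)] by simp
  qed
  then have "?J = UNIV" by blast
  then show ?thesis by (simp add: full_correspondence_def)
qed

end

lemma periodic_imp_faithful:
  assumes "periodic X"
  shows "faithful_correspondence X"
  unfolding faithful_correspondence_def
proof (rule injI)
  fix a b assume "restrict (lact X a) (carr X) = restrict (lact X b) (carr X)"
  then have eq: "lact X a x = lact X b x" if "x \<in> carr X" for x
    using that by (metis restrict_apply')
  obtain n U where n: "n \<ge> 1" and U: "bij_betw U (carr (tensor_power X n)) UNIV"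
    "\<And>c P. P \<in> carr (tensor_power X n) \<Longrightarrow> U (lact (tensor_power X n) c P) = c * U P"
    using assms
    by (auto simp: periodic_def correspondence_iso_def trivial_correspondence_def)
  (* a and b are recovered from their action on the vector that corresponds to 1 *)
  obtain P where P: "P \<in> carr (tensor_power X n)" "U P = 1"
    using U(1) by (metis UNIV_I bij_betw_def imageE)
  have words: "P \<subseteq> word_space X n"
    using P(1) by (auto simp: tensor_power_def null_rel_def elim!: quotientE)
  have lift: "free_lift (\<lambda>xs. Poly_Mapping.single (word_lact X a xs) 1) f =
      free_lift (\<lambda>xs. Poly_Mapping.single (word_lact X b xs) (1::complex)) f" if "f \<in> P" for f
    unfolding free_lift_def
  proof (intro sum.cong refl)
    fix xs assume "xs \<in> Poly_Mapping.keys f"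
    then have "length xs = n" "set xs \<subseteq> carr X"
      using words that by (auto simp: word_space_def)
    then have "hd xs \<in> carr X"
      using n by (cases xs) auto
    then show "Poly_Mapping.lookup f xs *\<^sub>C Poly_Mapping.single (word_lact X a xs) 1 =
        Poly_Mapping.lookup f xs *\<^sub>C Poly_Mapping.single (word_lact X b xs) (1::complex)"
      by (simp add: word_lact_def eq)
  qed
  have "lact (tensor_power X n) a P = lact (tensor_power X n) b P"
    using lift by (simp add: tensor_power_def)
  then show "a = b"
    using U(2)[OF P(1)] P(2) by (metis mult_1_right)
qed

section \<open>Periodic quantum graphs\<close>

lemma (in state_basis) edge_coordinatised:
  "coordinatised (edge_correspondence \<delta> \<psi> A) \<psi> E (\<lambda>e a t. coord e (tensor_lact a t))"
proof
  let ?S = "{tensor_ract (tensor_lact x (edge_element \<delta> \<psi> A)) y | x y. True}"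
  interpret la: Vector_Spaces.linear scaleC scaleC "tensor_lact c" for c :: 'b
    by (rule clinear_tensor_lact)
  interpret ti: Vector_Spaces.linear scaleC scaleC "tensor_inner \<psi> s" for s
    by (rule clinear_tensor_inner[OF clinear_state])
  show "faithful_state \<psi>" "finite E" by (fact state finite_basis)+
  fix s t :: "('b, 'b) tensor" and a b :: 'b
  have "tensor_lact a t \<in> cspan ?S" if "t \<in> cspan ?S"
    using that
  proof (induct rule: complex_vector.span_induct_alt)
    case base
    show ?case by (simp add: la.zero complex_vector.span_zero)
  next
    case (step c u v)
    from step(1) obtain x y where "u = tensor_ract (tensor_lact x (edge_element \<delta> \<psi> A)) y"
      by blast
    then have "tensor_lact a u = tensor_ract (tensor_lact (a * x) (edge_element \<delta> \<psi> A)) y"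
      by (simp add: tensor_lact_ract tensor_lact_mult)
    then have "tensor_lact a u \<in> ?S" by blast
    with step show ?case
      by (simp add: la.add la.scale complex_vector.span_add complex_vector.span_scale
          complex_vector.span_base)
  qed
  then show "t \<in> carr (edge_correspondence \<delta> \<psi> A) \<Longrightarrow>
      lact (edge_correspondence \<delta> \<psi> A) a t \<in> carr (edge_correspondence \<delta> \<psi> A)"
    by (simp add: edge_correspondence_def)
  show "cinner (edge_correspondence \<delta> \<psi> A) s (lact (edge_correspondence \<delta> \<psi> A) (a + b) t) =
      cinner (edge_correspondence \<delta> \<psi> A) s (lact (edge_correspondence \<delta> \<psi> A) a t) +
      cinner (edge_correspondence \<delta> \<psi> A) s (lact (edge_correspondence \<delta> \<psi> A) b t)"
    by (simp add: edge_correspondence_def tensor_lact_add ti.add)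
  have "tensor_inner \<psi> s (tensor_lact (star a * b) t) =
      tensor_inner \<psi> (tensor_lact a s) (tensor_lact b t)"
  proof (induct s rule: tensor_induct)
    case (elem x y)
    show ?case
      by (rule clinear_eq_on_elems[where t=t])
        (auto intro!: clinear_compose[OF clinear_tensor_inner[OF clinear_state]] clinear_tensor_lact
          simp: tensor_lact_elem tensor_inner_elem[OF clinear_state] star_mult mult.assoc)
  next
    case (add s s')
    then show ?case by (simp add: tensor_inner_add_left[OF clinear_state] la.add)
  qed
  then show "cinner (edge_correspondence \<delta> \<psi> A) s
        (lact (edge_correspondence \<delta> \<psi> A) (star a * b) t) =
      (\<Sum>e\<in>E. star (coord e (tensor_lact a s)) * coord e (tensor_lact b t))"
    by (simp add: edge_correspondence_def tensor_inner_coord)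
qed

text \<open>The projection onto a source acts on the edge correspondence as \<open>0\<close> does.\<close>

lemma (in state_basis) faithful_imp_no_source:
  assumes A: "clinear A" and faithful: "faithful_correspondence (edge_correspondence \<delta> \<psi> A)"
  shows "\<not> quantum_source A S"
proof
  assume "quantum_source A S"
  then obtain p where p: "\<And>x. p * x = x * p" "S = range (\<lambda>x. p * x)" "S \<noteq> {0}"
      "\<And>s. s \<in> S \<Longrightarrow> A s = 0"
    unfolding quantum_source_def central_summand_def by blast
  have "A (p * x) = 0" for x using p(4)[of "p * x"] p(2) by blast
  then have "tensor_lact p t = tensor_lact 0 t" if "t \<in> carr (edge_correspondence \<delta> \<psi> A)" for t
    using source_annihilates_edges[OF A p(1) _ that] tensor_lact_add[of 0 0 t] by simp
  then have "restrict (lact (edge_correspondence \<delta> \<psi> A) p) (carr (edge_correspondence \<delta> \<psi> A)) =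
      restrict (lact (edge_correspondence \<delta> \<psi> A) 0) (carr (edge_correspondence \<delta> \<psi> A))"
    by (intro restrict_ext) (simp add: edge_correspondence_def)
  then have "p = 0"
    using faithful by (auto simp: faithful_correspondence_def dest: injD)
  then show False using p(2,3) by auto
qed

text \<open>The projection \<open>p\<close> onto a sink annihilates all inner products, hence by density and continuity also
  \<open>1\<close>.\<close>

lemma (in state_basis) full_imp_no_sink:
  assumes A: "clinear A" and full: "full_correspondence (edge_correspondence \<delta> \<psi> A)"
  shows "\<not> quantum_sink \<psi> A S"
proof
  interpret ti: Vector_Spaces.linear scaleC scaleC "tensor_inner \<psi> s" for s
    by (rule clinear_tensor_inner[OF clinear_state])
  let ?X = "edge_correspondence \<delta> \<psi> A"
  let ?I = "{cinner ?X x y | x y. x \<in> carr ?X \<and> y \<in> carr ?X}"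
  assume "quantum_sink \<psi> A S"
  then obtain p where p: "\<And>x. p * x = x * p" "star p = p" "p * p = p" "S = range (\<lambda>x. p * x)"
      "S \<noteq> {0}" "\<And>s x. s \<in> S \<Longrightarrow> \<psi> (star s * A x) = 0"
    unfolding quantum_sink_def central_summand_def l2_inner_def by blast
  (* orthogonality to the vector p * A x of the summand says that p * A x has length zero *)
  have "p * A x = 0" for x
  proof -
    have "star (p * A x) * (p * A x) = star (p * A x) * A x"
      by (simp add: star_mult p(2) mult.assoc) (simp add: p(3) flip: mult.assoc)
    then have "\<psi> (star (p * A x) * (p * A x)) = 0"
      using p(4) p(6)[of "p * A x" x] by simp
    then show ?thesis using state by (simp add: faithful_state_def)
  qed
  then have "A x * p = 0" for x by (metis p(1))
  then have "tensor_inner \<psi> s t * p = 0" if "t \<in> carr ?X" for s t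
    using edges_annihilate_sink[OF A p(1) _ that]
    by (simp add: tensor_inner_ract[symmetric] ti.zero)
  then have "z * p = 0" if "z \<in> ?I" for z
    using that by (auto simp: edge_correspondence_def)
  then have "cspan ?I \<subseteq> {z. z * p = 0}"
    using cspan_image_zero[OF clinear_mult(2), of ?I p] by blast
  moreover have "closed {z. z * p = 0}"
    by (intro closed_Collect_eq continuous_intros)
  ultimately have "closure (cspan ?I) \<subseteq> {z. z * p = 0}"
    by (rule closure_minimal)
  then have "1 \<in> {z. z * p = 0}"
    using full unfolding full_correspondence_def by blast
  then have "p = 0" by simp
  then show False using p(4,5) by auto
qed

theorem proposition4p12:
  fixes \<psi> :: "'b::fin_dim_cstar_algebra \<Rightarrow> complex"
    and A :: "'b \<Rightarrow> 'b"
    and \<delta> :: real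
  assumes "delta_form \<delta> \<psi>"
    and "quantum_graph \<delta> \<psi> A"
    and "completely_positive A"
    and "periodic (edge_correspondence \<delta> \<psi> A)"
  shows "faithful_correspondence (edge_correspondence \<delta> \<psi> A) \<and>
         full_correspondence (edge_correspondence \<delta> \<psi> A) \<and>
         (\<nexists>S. quantum_source A S) \<and>
         (\<nexists>S. quantum_sink \<psi> A S)"
proof -
  obtain E where "state_basis \<psi> E"
    using assms(2) state_basis_exists by (auto simp: quantum_graph_def)
  then interpret state_basis \<psi> E .
  interpret X: coordinatised "edge_correspondence \<delta> \<psi> A" \<psi> E "\<lambda>e a t. coord e (tensor_lact a t)"
    by (rule edge_coordinatised)
  have A: "clinear A" using assms(2) by (simp add: quantum_graph_def)
  have "faithful_correspondence (edge_correspondence \<delta> \<psi> A)"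
    using assms(4) by (rule periodic_imp_faithful)
  moreover have "full_correspondence (edge_correspondence \<delta> \<psi> A)"
    using assms(4) by (rule X.periodic_imp_full)
  ultimately show ?thesis
    using faithful_imp_no_source[OF A] full_imp_no_sink[OF A] by blast
qed

end
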